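(* Let $n\geq 1$ and let $\Omega$ be a nonempty open subset of $\mathbb{R}^n$. Then neither the space $\mathcal{D}(\Omega)$ of test functions over $\Omega$ nor its strong dual $\mathcal{D}'(\Omega)$, the space of distributions, is $\kappa$-Fréchet--Urysohn.
   Context: A topological space $X$ is $\kappa$-Fréchet--Urysohn if for every open subset $U$ of $X$ and every $x\in\overline{U}$ there exists a sequence $\{x_n\}_{n\in\mathbb{N}}\subseteq U$ converging to $x$. $\mathcal{D}(\Omega)$ is the space of smooth compactly supported functions on $\Omega$ with its usual strict $(LF)$-space (locally convex inductive limit) topology; its strong dual $\mathcal{D}'(\Omega)$ is the space of continuous linear functionals on $\mathcal{D}(\Omega)$ with the topology of uniform convergence on bounded subsets of $\mathcal{D}(\Omega)$. *)

theory Defs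
  imports "HOL-Analysis.Analysis"
begin

definition kappa_Frechet_Urysohn :: "'a topology \<Rightarrow> bool" where
  "kappa_Frechet_Urysohn T \<longleftrightarrow>
     (\<forall>U x. openin T U \<and> x \<in> T closure_of U \<longrightarrow>
        (\<exists>\<sigma>::nat \<Rightarrow> 'a. range \<sigma> \<subseteq> U \<and> limitin T \<sigma> x sequentially))"


text \<open>
  All vector spaces below are sets of functions \<open>'x \<Rightarrow> 'k\<close> with pointwise operations. A scalar type of
  sort \<open>{real_normed_field, euclidean_space}\<close> is the real or the complex field.
\<close>

text \<open>
  The translation-invariant topology on \<open>X\<close> in which \<open>B\<close> is a base of neighbourhoods of 0. This presumes
  that \<open>B\<close> is a filter base and that each member of \<open>B\<close> includes \<open>V + V\<close> for another member \<open>V\<close>.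
\<close>

definition translation_topology ::
    "('x \<Rightarrow> 'k::ab_group_add) set \<Rightarrow> ('x \<Rightarrow> 'k) set set \<Rightarrow> ('x \<Rightarrow> 'k) topology" where
  "translation_topology X B =
     topology (\<lambda>U. U \<subseteq> X \<and> (\<forall>f\<in>U. \<exists>W\<in>B. \<forall>w\<in>W. (\<lambda>x. f x + w x) \<in> U))"

lemma openin_translation_topology:
  assumes "\<And>V W. V \<in> B \<Longrightarrow> W \<in> B \<Longrightarrow> \<exists>Z\<in>B. Z \<subseteq> V \<inter> W"
  shows "openin (translation_topology X B) U \<longleftrightarrow>
           U \<subseteq> X \<and> (\<forall>f\<in>U. \<exists>W\<in>B. \<forall>w\<in>W. (\<lambda>x. f x + w x) \<in> U)"
proof -
  have "istopology (\<lambda>U. U \<subseteq> X \<and> (\<forall>f\<in>U. \<exists>W\<in>B. \<forall>w\<in>W. (\<lambda>x. f x + w x) \<in> U))"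
    unfolding istopology_def
  proof (intro conjI allI impI ballI)
    fix S T f
    assume S: "S \<subseteq> X \<and> (\<forall>f\<in>S. \<exists>W\<in>B. \<forall>w\<in>W. (\<lambda>x. f x + w x) \<in> S)"
      and T: "T \<subseteq> X \<and> (\<forall>f\<in>T. \<exists>W\<in>B. \<forall>w\<in>W. (\<lambda>x. f x + w x) \<in> T)" and f: "f \<in> S \<inter> T"
    obtain V where V: "V \<in> B" "\<forall>w\<in>V. (\<lambda>x. f x + w x) \<in> S" using S f by blast
    obtain W where W: "W \<in> B" "\<forall>w\<in>W. (\<lambda>x. f x + w x) \<in> T" using T f by blast
    obtain Z where "Z \<in> B" "Z \<subseteq> V \<inter> W" using assms V W by blast
    then show "\<exists>Z\<in>B. \<forall>w\<in>Z. (\<lambda>x. f x + w x) \<in> S \<inter> T" using V W by blast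
  next
    fix \<K> f
    assume K: "\<forall>S\<in>\<K>. S \<subseteq> X \<and> (\<forall>f\<in>S. \<exists>W\<in>B. \<forall>w\<in>W. (\<lambda>x. f x + w x) \<in> S)" and "f \<in> \<Union>\<K>"
    then obtain S where S: "S \<in> \<K>" "f \<in> S" by blast
    then obtain W where "W \<in> B" "\<forall>w\<in>W. (\<lambda>x. f x + w x) \<in> S" using K by blast
    then show "\<exists>W\<in>B. \<forall>w\<in>W. (\<lambda>x. f x + w x) \<in> \<Union>\<K>" using S by blast
  qed blast+
  then show ?thesis
    unfolding translation_topology_def by simp
qed

definition absolutely_convex :: "('x \<Rightarrow> 'k::real_normed_field) set \<Rightarrow> bool" where
  "absolutely_convex W \<longleftrightarrow>
     W \<noteq> {} \<and> (\<forall>f\<in>W. \<forall>g\<in>W. \<forall>a b. norm a + norm b \<le> 1 \<longrightarrow> (\<lambda>x. a * f x + b * g x) \<in> W)"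

definition nbhd_of_zero :: "('x \<Rightarrow> 'k::real_normed_field) topology \<Rightarrow> ('x \<Rightarrow> 'k) set \<Rightarrow> bool" where
  "nbhd_of_zero T V \<longleftrightarrow> V \<subseteq> topspace T \<and> (\<exists>U. openin T U \<and> (\<lambda>_. 0) \<in> U \<and> U \<subseteq> V)"

definition vector_bounded :: "('x \<Rightarrow> 'k::real_normed_field) topology \<Rightarrow> ('x \<Rightarrow> 'k) set \<Rightarrow> bool" where
  "vector_bounded T A \<longleftrightarrow>
     A \<subseteq> topspace T \<and>
     (\<forall>V. nbhd_of_zero T V \<longrightarrow>
        (\<exists>r>0. \<forall>c::'k. r \<le> norm c \<longrightarrow> A \<subseteq> (\<lambda>f x. c * f x) ` V))"


text \<open>
  Iterated partial derivatives, indexed by the list of the directions. The order of the list is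
  irrelevant for smooth functions, so that these are the derivatives given by multi-indices of order
  equal to the length of the list.
\<close>

primrec partials :: "'n list \<Rightarrow> (real^'n \<Rightarrow> 'k::real_normed_vector) \<Rightarrow> real^'n \<Rightarrow> 'k" where
  "partials [] f = f"
| "partials (i # is) f = (\<lambda>x. frechet_derivative (partials is f) (at x) (axis i 1))"

definition smooth_on :: "(real^'n) set \<Rightarrow> (real^'n \<Rightarrow> 'k::real_normed_vector) \<Rightarrow> bool" where
  "smooth_on S f \<longleftrightarrow> (\<forall>is. \<forall>x\<in>S. partials is f differentiable (at x))"

definition fun_support :: "(real^'n \<Rightarrow> 'k::real_normed_vector) \<Rightarrow> (real^'n) set" where
  "fun_support f = closure {x. f x \<noteq> 0}"

text \<open>A test function on \<open>\<Omega>\<close> is represented by its extension by 0 to the whole space.\<close>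

definition test_functions :: "(real^'n) set \<Rightarrow> (real^'n \<Rightarrow> 'k::real_normed_vector) set" where
  "test_functions \<Omega> = {f. smooth_on \<Omega> f \<and> compact (fun_support f) \<and> fun_support f \<subseteq> \<Omega>}"

definition test_functions_in ::
    "(real^'n) set \<Rightarrow> (real^'n) set \<Rightarrow> (real^'n \<Rightarrow> 'k::real_normed_vector) set" where
  "test_functions_in \<Omega> K = {f \<in> test_functions \<Omega>. fun_support f \<subseteq> K}"

definition DK_basic :: "(real^'n) set \<Rightarrow> (real^'n) set \<Rightarrow> nat \<Rightarrow> real \<Rightarrow> (real^'n \<Rightarrow> 'k::real_normed_field) set"
  where
  "DK_basic \<Omega> K m \<epsilon> =
     {f \<in> test_functions_in \<Omega> K. \<forall>is. length is \<le> m \<longrightarrow> (\<forall>x\<in>K. norm (partials is f x) < \<epsilon>)}"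

definition DK_topology :: "(real^'n) set \<Rightarrow> (real^'n) set \<Rightarrow> (real^'n \<Rightarrow> 'k::real_normed_field) topology"
  where
  "DK_topology \<Omega> K =
     translation_topology (test_functions_in \<Omega> K) {DK_basic \<Omega> K m \<epsilon> | m \<epsilon>. 0 < \<epsilon>}"

text \<open>
  The locally convex inductive limit of the Frechet spaces \<open>test_functions_in \<Omega> K\<close>, for \<open>K\<close> a compact
  subset of \<open>\<Omega>\<close>. An exhausting sequence of compact sets gives the same topology, because each compact
  \<open>K\<close> is contained in a member of the sequence.
\<close>

definition LF_base :: "(real^'n) set \<Rightarrow> (real^'n \<Rightarrow> 'k::real_normed_field) set set" where
  "LF_base \<Omega> =
     {W. W \<subseteq> test_functions \<Omega> \<and> absolutely_convex W \<and>
         (\<forall>K. compact K \<and> K \<subseteq> \<Omega> \<longrightarrow>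
            nbhd_of_zero (DK_topology \<Omega> K) (W \<inter> test_functions_in \<Omega> K))}"

definition test_topology :: "(real^'n) set \<Rightarrow> (real^'n \<Rightarrow> 'k::real_normed_field) topology" where
  "test_topology \<Omega> = translation_topology (test_functions \<Omega>) (LF_base \<Omega>)"

text \<open>
  A functional on \<open>test_functions \<Omega>\<close> is represented by a total function which, in order to be unique,
  is 0 off \<open>test_functions \<Omega>\<close>.
\<close>

definition distributions :: "(real^'n) set \<Rightarrow> ((real^'n \<Rightarrow> 'k::real_normed_field) \<Rightarrow> 'k) set" where
  "distributions \<Omega> =
     {u. (\<forall>f. f \<notin> test_functions \<Omega> \<longrightarrow> u f = 0) \<and>
         (\<forall>f\<in>test_functions \<Omega>. \<forall>g\<in>test_functions \<Omega>. \<forall>a b.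
            u (\<lambda>x. a * f x + b * g x) = a * u f + b * u g) \<and>
         continuous_map (test_topology \<Omega>) euclidean u}"

definition strong_basic ::
    "(real^'n) set \<Rightarrow> (real^'n \<Rightarrow> 'k::real_normed_field) set \<Rightarrow> real \<Rightarrow> ((real^'n \<Rightarrow> 'k) \<Rightarrow> 'k) set" where
  "strong_basic \<Omega> A \<epsilon> = {u \<in> distributions \<Omega>. \<forall>f\<in>A. norm (u f) < \<epsilon>}"

definition distribution_topology ::
    "(real^'n) set \<Rightarrow> ((real^'n \<Rightarrow> 'k::real_normed_field) \<Rightarrow> 'k) topology" where
  "distribution_topology \<Omega> =
     translation_topology (distributions \<Omega>)
       {strong_basic \<Omega> A \<epsilon> | A \<epsilon>. vector_bounded (test_topology \<Omega>) A \<and> 0 < \<epsilon>}"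


text \<open>The three families of sets are filter bases, so that the definitions above are meaningful.\<close>

lemma openin_DK_topology:
  fixes U :: "(real^'n \<Rightarrow> 'k::real_normed_field) set"
  shows "openin (DK_topology \<Omega> K) U \<longleftrightarrow>
     U \<subseteq> test_functions_in \<Omega> K \<and>
     (\<forall>f\<in>U. \<exists>W\<in>{DK_basic \<Omega> K m \<epsilon> | m \<epsilon>. 0 < \<epsilon>}. \<forall>w\<in>W. (\<lambda>x. f x + w x) \<in> U)"
  unfolding DK_topology_def
proof (rule openin_translation_topology)
  fix V W :: "(real^'n \<Rightarrow> 'k) set"
  assume "V \<in> {DK_basic \<Omega> K m \<epsilon> | m \<epsilon>. 0 < \<epsilon>}" "W \<in> {DK_basic \<Omega> K m \<epsilon> | m \<epsilon>. 0 < \<epsilon>}"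
  then obtain m \<epsilon> k \<delta> where V: "V = DK_basic \<Omega> K m \<epsilon>" "0 < \<epsilon>" and W: "W = DK_basic \<Omega> K k \<delta>" "0 < \<delta>"
    by blast
  have "DK_basic \<Omega> K (max m k) (min \<epsilon> \<delta>) \<subseteq> V \<inter> W"
    unfolding V W DK_basic_def by auto
  moreover have "0 < min \<epsilon> \<delta>" using V W by simp
  ultimately show "\<exists>Z\<in>{DK_basic \<Omega> K m \<epsilon> | m \<epsilon>. 0 < \<epsilon>}. Z \<subseteq> V \<inter> W" by blast
qed

lemma nbhd_of_zero_Int:
  assumes "nbhd_of_zero T V" "nbhd_of_zero T W"
  shows "nbhd_of_zero T (V \<inter> W)"
proof -
  obtain S where S: "openin T S" "(\<lambda>_. 0) \<in> S" "S \<subseteq> V"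
    using assms(1) unfolding nbhd_of_zero_def by blast
  obtain U where U: "openin T U" "(\<lambda>_. 0) \<in> U" "U \<subseteq> W"
    using assms(2) unfolding nbhd_of_zero_def by blast
  have "openin T (S \<inter> U)" using S U by blast
  moreover have "V \<inter> W \<subseteq> topspace T" using assms(1) unfolding nbhd_of_zero_def by blast
  moreover have "(\<lambda>_. 0) \<in> S \<inter> U" "S \<inter> U \<subseteq> V \<inter> W" using S U by auto
  ultimately show ?thesis unfolding nbhd_of_zero_def by (intro conjI exI[of _ "S \<inter> U"])
qed

lemma absolutely_convex_zero:
  assumes "absolutely_convex W"
  shows "(\<lambda>_. 0) \<in> W"
proof -
  obtain f where "f \<in> W" using assms unfolding absolutely_convex_def by blast
  then have "(\<lambda>x. 0 * f x + 0 * f x) \<in> W"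
    using assms unfolding absolutely_convex_def by (metis add_0 norm_zero zero_le_one)
  then show ?thesis by simp
qed

lemma absolutely_convex_Int:
  assumes "absolutely_convex V" "absolutely_convex W"
  shows "absolutely_convex (V \<inter> W)"
proof -
  have "V \<inter> W \<noteq> {}" using absolutely_convex_zero assms by blast
  then show ?thesis using assms unfolding absolutely_convex_def by simp
qed

lemma openin_test_topology:
  fixes U :: "(real^'n \<Rightarrow> 'k::real_normed_field) set"
  shows "openin (test_topology \<Omega>) U \<longleftrightarrow>
     U \<subseteq> test_functions \<Omega> \<and> (\<forall>f\<in>U. \<exists>W\<in>LF_base \<Omega>. \<forall>w\<in>W. (\<lambda>x. f x + w x) \<in> U)"
  unfolding test_topology_def
proof (rule openin_translation_topology)
  fix V W :: "(real^'n \<Rightarrow> 'k) set"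
  assume V: "V \<in> LF_base \<Omega>" and W: "W \<in> LF_base \<Omega>"
  have "nbhd_of_zero (DK_topology \<Omega> K) ((V \<inter> W) \<inter> test_functions_in \<Omega> K)"
    if "compact K \<and> K \<subseteq> \<Omega>" for K
  proof -
    have "nbhd_of_zero (DK_topology \<Omega> K)
            ((V \<inter> test_functions_in \<Omega> K) \<inter> (W \<inter> test_functions_in \<Omega> K))"
    proof (rule nbhd_of_zero_Int)
      show "nbhd_of_zero (DK_topology \<Omega> K) (V \<inter> test_functions_in \<Omega> K)"
        using V that by (simp add: LF_base_def)
      show "nbhd_of_zero (DK_topology \<Omega> K) (W \<inter> test_functions_in \<Omega> K)"
        using W that by (simp add: LF_base_def)
    qed
    moreover have "(V \<inter> test_functions_in \<Omega> K) \<inter> (W \<inter> test_functions_in \<Omega> K)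
                 = (V \<inter> W) \<inter> test_functions_in \<Omega> K" by blast
    ultimately show ?thesis by simp
  qed
  moreover have "absolutely_convex (V \<inter> W)" "V \<inter> W \<subseteq> test_functions \<Omega>"
    using V W absolutely_convex_Int by (auto simp: LF_base_def)
  ultimately have "V \<inter> W \<in> LF_base \<Omega>"
    by (simp add: LF_base_def)
  then show "\<exists>Z\<in>LF_base \<Omega>. Z \<subseteq> V \<inter> W" by blast
qed

lemma vector_bounded_Un:
  fixes A C :: "('x \<Rightarrow> 'k::real_normed_field) set"
  assumes "vector_bounded T A" "vector_bounded T C"
  shows "vector_bounded T (A \<union> C)"
  unfolding vector_bounded_def
proof (intro conjI allI impI)
  show "A \<union> C \<subseteq> topspace T" using assms unfolding vector_bounded_def by blast
  fix V assume V: "nbhd_of_zero T V"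
  obtain r where r: "r > 0" "\<forall>c::'k. r \<le> norm c \<longrightarrow> A \<subseteq> (\<lambda>f x. c * f x) ` V"
    using assms(1) V unfolding vector_bounded_def by blast
  obtain s where s: "s > 0" "\<forall>c::'k. s \<le> norm c \<longrightarrow> C \<subseteq> (\<lambda>f x. c * f x) ` V"
    using assms(2) V unfolding vector_bounded_def by blast
  show "\<exists>r>0. \<forall>c::'k. r \<le> norm c \<longrightarrow> A \<union> C \<subseteq> (\<lambda>f x. c * f x) ` V"
    using r s by (intro exI[of _ "max r s"]) simp
qed

lemma openin_distribution_topology:
  fixes U :: "((real^'n \<Rightarrow> 'k::real_normed_field) \<Rightarrow> 'k) set"
  shows "openin (distribution_topology \<Omega>) U \<longleftrightarrow>
     U \<subseteq> distributions \<Omega> \<and>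
     (\<forall>u\<in>U. \<exists>W\<in>{strong_basic \<Omega> A \<epsilon> | A \<epsilon>. vector_bounded (test_topology \<Omega>) A \<and> 0 < \<epsilon>}.
        \<forall>w\<in>W. (\<lambda>f. u f + w f) \<in> U)"
  unfolding distribution_topology_def
proof (rule openin_translation_topology)
  let ?B = "{strong_basic \<Omega> A \<epsilon> | A \<epsilon>. vector_bounded (test_topology \<Omega>) A \<and> 0 < \<epsilon>}"
  fix V W :: "((real^'n \<Rightarrow> 'k) \<Rightarrow> 'k) set"
  assume "V \<in> ?B" "W \<in> ?B"
  then obtain A \<epsilon> C \<delta> where V: "V = strong_basic \<Omega> A \<epsilon>" "vector_bounded (test_topology \<Omega>) A" "0 < \<epsilon>"
    and W: "W = strong_basic \<Omega> C \<delta>" "vector_bounded (test_topology \<Omega>) C" "0 < \<delta>"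
    by blast
  have "strong_basic \<Omega> (A \<union> C) (min \<epsilon> \<delta>) \<subseteq> V \<inter> W"
    unfolding V W strong_basic_def by auto
  moreover have "0 < min \<epsilon> \<delta>" using V(3) W(3) by simp
  ultimately show "\<exists>Z\<in>?B. Z \<subseteq> V \<inter> W" 
    using vector_bounded_Un[OF V(2) W(2)] by blast
qed

end

theory Submission
  imports Defs
begin

text \<open>
  Test functions: let \<open>X n\<close> be a sequence in \<open>\<Omega>\<close> that leaves every compact subset, \<open>p \<in> \<Omega>\<close>, and let \<open>U\<close>
  consist of the \<open>f\<close> such that \<open>1 / (n + 1) < norm (f p)\<close> and \<open>f (X n) \<noteq> 0\<close> for some \<open>n\<close> with \<open>X n \<noteq> p\<close>.
  Then 0 is in the closure of the open set \<open>U\<close>. If \<open>\<sigma> k \<in> U\<close> tends to 0, with witnesses \<open>\<nu> k\<close>, then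
  \<open>\<nu> k\<close> tends to infinity because \<open>\<sigma> k p\<close> tends to 0, so that only finitely many \<open>k\<close> constrain each
  point of the sequence \<open>X\<close>. Hence there are positive \<open>\<epsilon> (X n)\<close> such that the neighbourhood of the \<open>f\<close>
  with \<open>norm (f (X n)) < \<epsilon> (X n)\<close> for all \<open>n\<close> contains no \<open>\<sigma> k\<close>.

  Distributions: choose test functions \<open>g n m\<close> with support in a fixed compact set, whose derivatives up
  to order \<open>n\<close> are bounded by 1 while one derivative of order \<open>n + 1\<close> exceeds \<open>m\<close>, and \<open>f0\<close> with support
  disjoint from theirs. Let \<open>U\<close> consist of the \<open>u\<close> such that \<open>1 / (n + 1) < norm (u f0)\<close> and
  \<open>1 < norm (u (g n m))\<close> for some \<open>n\<close>, \<open>m\<close>. Small multiples of point evaluations of derivatives show that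
  0 is in the closure of \<open>U\<close>. Along a sequence in \<open>U\<close> that tends to 0 the witnesses \<open>n\<close> tend to infinity,
  so that the witnesses \<open>g n m\<close> form a bounded set, on which the sequence would have to tend to 0
  uniformly.
\<close>

section \<open>Smooth bump functions\<close>

text \<open>The classical flat function exp(-1/t), extended by 0. Dividing by powers of
  \<open>t\<close> makes the family closed under differentiation up to linear combinations.\<close>

definition flat_exp :: "nat \<Rightarrow> real \<Rightarrow> real" where
  "flat_exp k t = (if t > 0 then exp (- (1 / t)) / t ^ k else 0)"

lemma power_div_fact_le_exp:
  fixes x :: real
  assumes "0 \<le> x"
  shows "x ^ n / fact n \<le> exp x"
proof -
  have "sum (\<lambda>n. x ^ n /\<^sub>R fact n) {n} \<le> (\<Sum>n. x ^ n /\<^sub>R fact n)"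
    using assms by (intro sum_le_suminf summable_exp_generic) auto
  then show ?thesis by (simp add: exp_def divide_inverse mult.commute)
qed

text \<open>A single term of the exponential series at 1/t already beats the power in the
  denominator. Two spare powers of \<open>t\<close> are kept so that the difference quotient at 0 is
  still O(|h|).\<close>

lemma abs_flat_exp_le: "\<bar>flat_exp k t\<bar> \<le> fact (k + 2) * t\<^sup>2"
proof (cases "t > 0")
  case True
  have "(1 / t) ^ (k + 2) / fact (k + 2) \<le> exp (1 / t)"
    using True by (intro power_div_fact_le_exp) simp
  then have "1 \<le> exp (1 / t) * (fact (k + 2) * t ^ (k + 2))"
    using True by (simp add: power_divide divide_simps mult_ac)
  then have "exp (- (1 / t)) \<le> fact (k + 2) * t ^ (k + 2)"
    using True by (simp add: exp_minus field_simps)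
  then have "exp (- (1 / t)) / t ^ k \<le> fact (k + 2) * t\<^sup>2"
    using True by (simp add: divide_simps power_add power2_eq_square mult_ac)
  then show ?thesis using True by (simp add: flat_exp_def)
qed (simp add: flat_exp_def)

text \<open>On either side of 0 this is calculus with a local formula; at 0 the quadratic bound
  forces the difference quotient to 0.\<close>

lemma DERIV_flat_exp:
  "(flat_exp k has_real_derivative flat_exp (k + 2) t - real k * flat_exp (k + 1) t) (at t)"
proof (cases t "0 :: real" rule: linorder_cases)
  case less
  have "(flat_exp k has_real_derivative 0) (at t)"
    by (rule has_field_derivative_transform_within_open[OF DERIV_const[of 0], where S = "{..<0}"])
      (use less in \<open>auto simp: flat_exp_def\<close>)
  then show ?thesis using less by (simp add: flat_exp_def)
next
  case equal
  have "((\<lambda>h. flat_exp k h / h) \<longlongrightarrow> 0) (at 0)"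
  proof (rule Lim_null_comparison)
    show "\<forall>\<^sub>F h in at 0. norm (flat_exp k h / h) \<le> fact (k + 2) * \<bar>h\<bar>"
    proof (rule eventuallyI)
      fix h :: real
      show "norm (flat_exp k h / h) \<le> fact (k + 2) * \<bar>h\<bar>"
        using abs_flat_exp_le[of k h]
        by (cases "h = 0") (auto simp: abs_divide divide_simps power2_eq_square mult.assoc)
    qed
    show "((\<lambda>h::real. fact (k + 2) * \<bar>h\<bar>) \<longlongrightarrow> 0) (at 0)"
      by (intro tendsto_eq_intros refl) auto
  qed
  then show ?thesis
    using equal by (simp add: has_field_derivative_iff flat_exp_def[of _ 0])
next
  case greater
  have "((\<lambda>t. exp (- (1 / t)) / t ^ k) has_real_derivative
          flat_exp (k + 2) t - real k * flat_exp (k + 1) t) (at t)"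
  proof -
    have e: "((\<lambda>t. exp (- (1 / t))) has_real_derivative exp (- (1 / t)) / t\<^sup>2) (at t)"
      using greater by (auto intro!: derivative_eq_intros simp: power2_eq_square)
    have "((\<lambda>t. exp (- (1 / t)) / t ^ k) has_real_derivative
        (exp (- (1 / t)) / t\<^sup>2 * t ^ k - exp (- (1 / t)) * (real k * t ^ (k - Suc 0))) / (t ^ k * t ^ k)) (at t)"
      using greater by (intro DERIV_divide e DERIV_pow) simp
    \<comment> \<open>The case split on \<open>k\<close> below deals with the truncated exponent
      \<open>k - Suc 0\<close>, harmless at \<open>k = 0\<close> because of the factor
      \<open>real k\<close>.\<close>
    moreover have "(exp (- (1 / t)) / t\<^sup>2 * t ^ k - exp (- (1 / t)) * (real k * t ^ (k - Suc 0))) / (t ^ k * t ^ k)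
        = flat_exp (k + 2) t - real k * flat_exp (k + 1) t"
      using greater by (cases k) (simp_all add: flat_exp_def field_simps power2_eq_square)
    ultimately show ?thesis by simp
  qed
  then show ?thesis
    by (rule has_field_derivative_transform_within_open[where S = "{0<..}"])
      (use greater in \<open>auto simp: flat_exp_def\<close>)
qed

text \<open>
  Closed under partial derivatives, which shows smoothness without a formula for the derivatives.
\<close>

inductive_set bump_algebra :: "(real^'n \<Rightarrow> 'k::real_normed_field) set" where
  base: "(\<lambda>x. of_real (flat_exp k (1 - x \<bullet> x))) \<in> bump_algebra"
| add: "f \<in> bump_algebra \<Longrightarrow> g \<in> bump_algebra \<Longrightarrow> (\<lambda>x. f x + g x) \<in> bump_algebra"
| scale: "f \<in> bump_algebra \<Longrightarrow> (\<lambda>x. c *\<^sub>R f x) \<in> bump_algebra"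
| coordinate: "f \<in> bump_algebra \<Longrightarrow> (\<lambda>x. (x $ i) *\<^sub>R f x) \<in> bump_algebra"

text \<open>Induction over the generators. One derivative \<open>D\<close> serves for both claims,
  so that iterating needs nothing but membership in the algebra.\<close>

lemma bump_algebra_derivative:
  fixes f :: "real^'n \<Rightarrow> 'k::real_normed_field"
  assumes "f \<in> bump_algebra"
  shows "\<exists>D. (\<forall>x. (f has_derivative D x) (at x)) \<and> (\<forall>i. (\<lambda>x. D x (axis i 1)) \<in> bump_algebra)"
  using assms
proof induction
  case (base k)
  let ?d = "\<lambda>t. flat_exp (k + 2) t - real k * flat_exp (k + 1) t"
  let ?D = "\<lambda>(x :: real^'n) (v :: real^'n). of_real (?d (1 - x \<bullet> x) * (- 2 * (x \<bullet> v))) :: 'k"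
  have D: "((\<lambda>x. of_real (flat_exp k (1 - x \<bullet> x))) has_derivative ?D x) (at x)" for x
  proof -
    have "((\<lambda>x. 1 - x \<bullet> x) has_derivative (\<lambda>v. - 2 * (x \<bullet> v))) (at x)"
      by (auto intro!: derivative_eq_intros simp: inner_commute)
    then have "((\<lambda>x. flat_exp k (1 - x \<bullet> x)) has_derivative (\<lambda>v. ?d (1 - x \<bullet> x) * (- 2 * (x \<bullet> v)))) (at x)"
      by (rule has_derivative_compose)
        (rule DERIV_flat_exp[unfolded has_field_derivative_def])
    then show ?thesis by (rule has_derivative_of_real)
  qed
  have "(\<lambda>x. ?D x (axis i 1)) \<in> bump_algebra" for i
  proof -
    \<comment> \<open>The chain rule contributes the inner derivative -2 times the coordinate
      \<open>x $ i\<close>; here the result is arranged in the form that the closure rules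
      build.\<close>
    have "(\<lambda>x. (x $ i) *\<^sub>R ((- 2) *\<^sub>R of_real (flat_exp (k + 2) (1 - x \<bullet> x))
              + (2 * real k) *\<^sub>R of_real (flat_exp (k + 1) (1 - x \<bullet> x)))) \<in> (bump_algebra :: (real^'n \<Rightarrow> 'k) set)"
      by (intro bump_algebra.intros)
    moreover have "(\<lambda>x. (x $ i) *\<^sub>R ((- 2) *\<^sub>R of_real (flat_exp (k + 2) (1 - x \<bullet> x))
              + (2 * real k) *\<^sub>R of_real (flat_exp (k + 1) (1 - x \<bullet> x)))) = (\<lambda>x. ?D x (axis i 1))"
    proof
      fix x :: "real^'n"
      let ?a = "flat_exp (k + 2) (1 - x \<bullet> x)" and ?b = "flat_exp (k + 1) (1 - x \<bullet> x)"
      have "(x $ i) *\<^sub>R ((- 2) *\<^sub>R of_real ?a + (2 * real k) *\<^sub>R of_real ?b)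
          = of_real ((x $ i) * ((- 2) * ?a + (2 * real k) * ?b))"
        by (simp add: scaleR_conv_of_real)
      also have "(x $ i) * ((- 2) * ?a + (2 * real k) * ?b) = ?d (1 - x \<bullet> x) * (- 2 * (x \<bullet> axis i 1))"
        by (simp add: inner_axis algebra_simps)
      finally show "(x $ i) *\<^sub>R ((- 2) *\<^sub>R of_real ?a + (2 * real k) *\<^sub>R of_real ?b) = ?D x (axis i 1)" .
    qed
    ultimately show ?thesis by (simp only:)
  qed
  then show ?case using D by (intro exI[of _ ?D]) simp
next
  case (add f g)
  then obtain D E where
    "\<forall>x. (f has_derivative D x) (at x)" "\<forall>i. (\<lambda>x. D x (axis i 1)) \<in> bump_algebra"
    "\<forall>x. (g has_derivative E x) (at x)" "\<forall>i. (\<lambda>x. E x (axis i 1)) \<in> bump_algebra"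
    by blast
  then show ?case
    by (intro exI[of _ "\<lambda>x v. D x v + E x v"])
      (auto intro!: bump_algebra.add has_derivative_add)
next
  case (scale f c)
  then obtain D where
    "\<forall>x. (f has_derivative D x) (at x)" "\<forall>i. (\<lambda>x. D x (axis i 1)) \<in> bump_algebra"
    by blast
  then show ?case
    by (intro exI[of _ "\<lambda>x v. c *\<^sub>R D x v"])
      (auto intro!: bump_algebra.scale has_derivative_scaleR_right)
next
  case (coordinate f j)
  then obtain D where D:
    "\<And>x. (f has_derivative D x) (at x)" "\<And>i. (\<lambda>x. D x (axis i 1)) \<in> bump_algebra"
    by blast
  have "((\<lambda>x. (x $ j) *\<^sub>R f x) has_derivative (\<lambda>v. (x $ j) *\<^sub>R D x v + (v $ j) *\<^sub>R f x)) (at x)" for x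
    by (intro has_derivative_scaleR bounded_linear_imp_has_derivative bounded_linear_vec_nth D(1))
  moreover have "(\<lambda>x. (x $ j) *\<^sub>R D x (axis i 1) + (axis i 1 $ j) *\<^sub>R f x) \<in> bump_algebra" for i
    by (intro bump_algebra.intros D coordinate)
  ultimately show ?case
    by (intro exI[of _ "\<lambda>x v. (x $ j) *\<^sub>R D x v + (v $ j) *\<^sub>R f x"]) simp
qed

lemma partials_bump_algebra:
  assumes "f \<in> bump_algebra"
  shows "partials is f \<in> bump_algebra"
proof (induction "is")
  case (Cons i "is")
  obtain D where D: "\<And>x. (partials is f has_derivative D x) (at x)"
    "\<And>i. (\<lambda>x. D x (axis i 1)) \<in> bump_algebra"
    using bump_algebra_derivative[OF Cons] by blast
  then have "partials (i # is) f = (\<lambda>x. D x (axis i 1))"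
    by (simp add: frechet_derivative_at[OF D(1), symmetric])
  then show ?case using D(2) by simp
qed (use assms in simp)

lemma bump_algebra_smooth:
  assumes "f \<in> bump_algebra"
  shows "smooth_on UNIV f"
  unfolding smooth_on_def
  using bump_algebra_derivative[OF partials_bump_algebra[OF assms]] differentiableI by blast

text \<open>The standard radial mollifier exp(-1/(1 - |x|^2)) on the unit ball, without
  normalisation.\<close>

definition bump :: "real^'n \<Rightarrow> 'k::real_normed_field" where
  "bump x = of_real (flat_exp 0 (1 - x \<bullet> x))"

lemma smooth_bump: "smooth_on UNIV (bump :: real^'n \<Rightarrow> 'k::real_normed_field)"
  using bump_algebra_smooth[OF bump_algebra.base[of 0]] by (simp add: bump_def[abs_def])

lemma bump_zero: "bump 0 \<noteq> (0 :: 'k::real_normed_field)"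
  by (simp add: bump_def flat_exp_def)

lemma bump_eq_0: "1 \<le> norm x \<Longrightarrow> (bump x :: 'k::real_normed_field) = 0"
  using one_le_power[of "norm x" 2]
  by (simp add: bump_def flat_exp_def dot_square_norm not_less)

section \<open>Iterated partial derivatives\<close>

lemma smooth_on_UNIVD: "smooth_on UNIV f \<Longrightarrow> partials is f differentiable (at x)"
  by (simp add: smooth_on_def)

lemma smooth_has_derivative:
  "smooth_on UNIV f \<Longrightarrow>
     (partials is f has_derivative frechet_derivative (partials is f) (at x)) (at x)"
  using frechet_derivative_works smooth_on_UNIVD by blast

text \<open>By the chain rule each differentiation releases one factor \<open>c\<close>. Rescaling
  thus weighs derivatives according to their order, which is how steep test functions arise
  later.\<close>

lemma partials_affine:
  assumes "smooth_on UNIV f"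
  shows "partials is (\<lambda>x. f (c *\<^sub>R (x - a))) = (\<lambda>x. c ^ length is *\<^sub>R partials is f (c *\<^sub>R (x - a)))"
proof (induction "is")
  case (Cons i "is")
  have "((\<lambda>x. c ^ length is *\<^sub>R partials is f (c *\<^sub>R (x - a))) has_derivative
      (\<lambda>v. c ^ length is *\<^sub>R frechet_derivative (partials is f) (at (c *\<^sub>R (x - a))) (c *\<^sub>R v))) (at x)"
    for x
    by (intro has_derivative_scaleR_right has_derivative_compose[OF _ smooth_has_derivative[OF assms]])
      (auto intro!: derivative_eq_intros)
  from frechet_derivative_at[OF this, symmetric] show ?case
    using linear_scale[OF linear_frechet_derivative[OF smooth_on_UNIVD[OF assms]]]
    by (simp add: Cons mult.commute)
qed simp

lemma partials_lincomb:
  fixes f g :: "real^'n \<Rightarrow> 'k::real_normed_field"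
  assumes "smooth_on UNIV f" "smooth_on UNIV g"
  shows "partials is (\<lambda>x. a * f x + b * g x) = (\<lambda>x. a * partials is f x + b * partials is g x)"
proof (induction "is")
  case (Cons i "is")
  have "((\<lambda>x. a * partials is f x + b * partials is g x) has_derivative
      (\<lambda>v. a * frechet_derivative (partials is f) (at x) v
          + b * frechet_derivative (partials is g) (at x) v)) (at x)" for x
    by (intro has_derivative_add has_derivative_mult_right smooth_has_derivative assms)
  from frechet_derivative_at[OF this, symmetric] show ?case
    by (simp add: Cons)
qed simp

lemma smooth_on_affine:
  assumes "smooth_on UNIV f"
  shows "smooth_on UNIV (\<lambda>x. f (c *\<^sub>R (x - a)))"
  unfolding smooth_on_def partials_affine[OF assms]
  by (auto intro!: derivative_intros differentiable_compose[OF smooth_on_UNIVD[OF assms]])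

lemma smooth_on_lincomb:
  fixes f g :: "real^'n \<Rightarrow> 'k::real_normed_field"
  assumes "smooth_on UNIV f" "smooth_on UNIV g"
  shows "smooth_on UNIV (\<lambda>x. a * f x + b * g x)"
  unfolding smooth_on_def partials_lincomb[OF assms]
  by (auto intro!: derivative_intros smooth_on_UNIVD assms)

section \<open>Supports and the vector space of test functions\<close>

lemma closed_fun_support: "closed (fun_support f)"
  by (simp add: fun_support_def)

text \<open>The complement of the support is open, so a derivative that vanishes there vanishes near
  each of its points and can be differentiated again.\<close>

lemma partials_eq_0:
  assumes "x \<notin> fun_support f"
  shows "partials is f x = 0"
  using assms
proof (induction "is" arbitrary: x)
  case Nil
  then have "f x = 0" using closure_subset[of "{x. f x \<noteq> 0}"] unfolding fun_support_def by auto
  then show ?case by simp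
next
  case (Cons i "is")
  have "(partials is f has_derivative (\<lambda>_. 0)) (at x)"
  proof (rule has_derivative_transform_within_open)
    show "open (- fun_support f)" "x \<in> - fun_support f"
      using closed_fun_support Cons.prems by auto
    show "((\<lambda>_. 0) has_derivative (\<lambda>_. 0)) (at x)" by simp
    show "\<And>y. y \<in> - fun_support f \<Longrightarrow> 0 = partials is f y"
      by (simp add: Cons.IH)
  qed
  then have "frechet_derivative (partials is f) (at x) = (\<lambda>_. 0)"
    by (rule frechet_derivative_at[symmetric])
  then show ?case by simp
qed

text \<open>Off the support all derivatives are locally 0, so smoothness on \<open>\<Omega>\<close>
  extends to the whole space and the global calculus rules apply.\<close>

lemma test_function_smooth:
  assumes "f \<in> test_functions \<Omega>"
  shows "smooth_on UNIV f"
  unfolding smooth_on_def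
proof (intro allI ballI)
  fix "is" x
  show "partials is f differentiable (at x)"
  proof (cases "x \<in> fun_support f")
    case True
    then show ?thesis using assms by (auto simp: test_functions_def smooth_on_def)
  next
    case False
    have "(partials is f has_derivative (\<lambda>_. 0)) (at x)"
    proof (rule has_derivative_transform_within_open)
      show "open (- fun_support f)" "x \<in> - fun_support f"
        using closed_fun_support False by auto
      show "((\<lambda>_. 0) has_derivative (\<lambda>_. 0)) (at x)" by simp
      show "\<And>y. y \<in> - fun_support f \<Longrightarrow> 0 = partials is f y"
        by (simp add: partials_eq_0)
    qed
    then show ?thesis by (rule differentiableI)
  qed
qed

lemma test_function_lincomb:
  fixes f g :: "real^'n \<Rightarrow> 'k::real_normed_field"
  assumes "f \<in> test_functions_in \<Omega> K" "g \<in> test_functions_in \<Omega> K" "closed K"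
  shows "(\<lambda>x. a * f x + b * g x) \<in> test_functions_in \<Omega> K"
proof -
  let ?h = "\<lambda>x. a * f x + b * g x"
  have fg: "f \<in> test_functions \<Omega>" "g \<in> test_functions \<Omega>"
    using assms by (auto simp: test_functions_in_def)
  have "fun_support ?h \<subseteq> fun_support f \<union> fun_support g"
    unfolding fun_support_def closure_Un[symmetric] by (rule closure_mono) auto
  moreover have "compact (fun_support f \<union> fun_support g)"
    using fg by (auto simp: test_functions_def)
  moreover have "smooth_on UNIV ?h"
    using smooth_on_lincomb[OF test_function_smooth test_function_smooth, OF fg] .
  moreover have "closed (fun_support ?h)" by (simp add: fun_support_def)
  ultimately show ?thesis
    using assms fg compact_Int_closed[of "fun_support f \<union> fun_support g" "fun_support ?h"]
    by (auto simp: test_functions_in_def test_functions_def smooth_on_def inf.absorb2)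
qed

lemma test_functions_lincomb:
  fixes f g :: "real^'n \<Rightarrow> 'k::real_normed_field"
  assumes "f \<in> test_functions \<Omega>" "g \<in> test_functions \<Omega>"
  shows "(\<lambda>x. a * f x + b * g x) \<in> test_functions \<Omega>"
  using test_function_lincomb[of f \<Omega> UNIV g a b] assms by (simp add: test_functions_in_def)

lemma partials_test_lincomb:
  fixes f g :: "real^'n \<Rightarrow> 'k::real_normed_field"
  assumes "f \<in> test_functions \<Omega>" "g \<in> test_functions \<Omega>"
  shows "partials is (\<lambda>x. a * f x + b * g x) x = a * partials is f x + b * partials is g x"
  using partials_lincomb[OF test_function_smooth test_function_smooth, OF assms] by metis

text \<open>The derivative is continuous on the compact support and 0 elsewhere.\<close>

lemma test_function_partials_bounded:
  assumes "f \<in> test_functions \<Omega>"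
  shows "\<exists>C. \<forall>x. norm (partials is f x) \<le> C"
proof -
  have "continuous_on (fun_support f) (partials is f)"
    using smooth_on_UNIVD[OF test_function_smooth[OF assms]]
    by (meson continuous_at_imp_continuous_on differentiable_imp_continuous_within)
  moreover have "compact (fun_support f)" using assms by (simp add: test_functions_def)
  ultimately have "bounded (partials is f ` fun_support f)"
    by (simp add: compact_continuous_image compact_imp_bounded)
  then obtain C where C: "\<And>x. x \<in> fun_support f \<Longrightarrow> norm (partials is f x) \<le> C" 
    by (auto simp: bounded_iff)
  have "norm (partials is f x) \<le> max C 0" for x
    using C[of x] partials_eq_0[of x f "is"] by (cases "x \<in> fun_support f") auto
  then show ?thesis by blast
qed

section \<open>Rescaled bumps and nonvanishing of their derivatives\<close>

lemma bump_rescaled: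
  fixes a :: "real^'n" and s :: real
  assumes "0 < s" "cball a (1 / s) \<subseteq> \<Omega>"
  shows "(\<lambda>x. c * bump (s *\<^sub>R (x - a)) :: 'k::real_normed_field) \<in> test_functions_in \<Omega> (cball a (1 / s))"
    and "partials is (\<lambda>x. c * bump (s *\<^sub>R (x - a)) :: 'k) x
           = c * s ^ length is *\<^sub>R partials is bump (s *\<^sub>R (x - a))"
proof -
  let ?f = "\<lambda>x. bump (s *\<^sub>R (x - a)) :: 'k"
  let ?g = "\<lambda>x. c * bump (s *\<^sub>R (x - a)) :: 'k"
  have f: "smooth_on UNIV ?f" by (rule smooth_on_affine[OF smooth_bump])
  have "smooth_on UNIV ?g"
    using smooth_on_lincomb[OF f f, of c 0] by simp
  moreover have sub: "fun_support ?g \<subseteq> cball a (1 / s)"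
    unfolding fun_support_def
  proof (rule closure_minimal)
    show "{x. ?g x \<noteq> 0} \<subseteq> cball a (1 / s)"
    proof clarify
      fix x assume "c * bump (s *\<^sub>R (x - a)) \<noteq> (0::'k)"
      then have "norm (s *\<^sub>R (x - a)) < 1" using bump_eq_0[where 'k = 'k] by (metis mult_zero_right not_le)
      then show "x \<in> cball a (1 / s)"
        using assms(1) by (simp add: dist_norm norm_minus_commute pos_le_divide_eq mult.commute)
    qed
  qed simp
  moreover have "compact (fun_support ?g)"
    using sub by (metis bounded_subset bounded_cball closed_closure compact_eq_bounded_closed fun_support_def)
  ultimately show "?g \<in> test_functions_in \<Omega> (cball a (1 / s))"
    using assms(2) by (auto simp: test_functions_in_def test_functions_def smooth_on_def)
  show "partials is ?g x = c * s ^ length is *\<^sub>R partials is bump (s *\<^sub>R (x - a))"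
    using partials_lincomb[OF f f, of "is" c 0] partials_affine[OF smooth_bump[where 'k = 'k], of "is" s a]
    by simp
qed

text \<open>If the next derivative vanished identically, the current one would be constant along
  lines in direction \<open>i\<close>; but such lines leave the support, where it is 0.\<close>

lemma partials_replicate_bump_nonzero:
  "\<exists>z. partials (replicate m i) (bump :: real^'n \<Rightarrow> 'k::real_normed_field) z \<noteq> 0"
proof (induction m)
  case 0
  then show ?case using bump_zero by auto
next
  case (Suc m)
  let ?h = "partials (replicate m i) (bump :: real^'n \<Rightarrow> 'k)"
  obtain z where z: "?h z \<noteq> 0" using Suc by blast
  show ?case
  proof (rule ccontr)
    assume "\<nexists>z. partials (replicate (Suc m) i) (bump :: real^'n \<Rightarrow> 'k) z \<noteq> 0"
    then have D0: "frechet_derivative ?h (at x) (axis i 1) = 0" for x by simp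
    have D: "((\<lambda>t. ?h (z + t *\<^sub>R axis i 1)) has_derivative (\<lambda>_. 0)) (at t)" for t :: real
    proof -
      have "((\<lambda>t. ?h (z + t *\<^sub>R axis i 1)) has_derivative
              (\<lambda>s. frechet_derivative ?h (at (z + t *\<^sub>R axis i 1)) (s *\<^sub>R axis i 1))) (at t)"
        by (rule has_derivative_compose[OF _ smooth_has_derivative[OF smooth_bump]])
          (auto intro!: derivative_eq_intros)
      moreover have "linear (frechet_derivative ?h (at x))" for x
        by (intro linear_frechet_derivative smooth_on_UNIVD smooth_bump)
      then have "frechet_derivative ?h (at x) (s *\<^sub>R axis i 1) = 0" for x s
        by (simp add: linear_scale D0)
      ultimately show ?thesis by simp
    qed
    \<comment> \<open>Large enough for the shifted point to have norm at least 2, outside the closed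
      unit ball that contains the support.\<close>
    define t where "t = norm z + 2"
    have "?h (z + 0 *\<^sub>R axis i 1) = ?h (z + t *\<^sub>R axis i 1)"
      by (rule has_derivative_zero_unique[of UNIV "\<lambda>t. ?h (z + t *\<^sub>R axis i 1)"]) (use D in auto)
    moreover have "z + t *\<^sub>R axis i 1 \<notin> fun_support (bump :: real^'n \<Rightarrow> 'k)"
    proof -
      have "{x :: real^'n. bump x \<noteq> (0::'k)} \<subseteq> cball 0 1"
      proof clarify
        fix x :: "real^'n" assume "bump x \<noteq> (0::'k)"
        then have "\<not> 1 \<le> norm x" using bump_eq_0 by blast
        then show "x \<in> cball 0 1" by simp
      qed
      then have "fun_support (bump :: real^'n \<Rightarrow> 'k) \<subseteq> cball 0 1"
        unfolding fun_support_def by (rule closure_minimal) simp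
      moreover have "norm (t *\<^sub>R axis i (1::real)) \<le> norm (z + t *\<^sub>R axis i 1) + norm z"
        using norm_triangle_ineq4[of "z + t *\<^sub>R axis i 1" z] by simp
      then have "norm (z + t *\<^sub>R axis i 1) > 1" by (simp add: t_def)
      ultimately show ?thesis by auto
    qed
    ultimately show False using z partials_eq_0 by force
  qed
qed

section \<open>Neighbourhoods of zero and bounded sets of test functions\<close>

lemma partials_zero [simp]:
  "partials is (\<lambda>_::real^'n. 0 :: 'b::real_normed_vector) = (\<lambda>_. 0)"
proof
  fix x :: "real^'n"
  show "partials is (\<lambda>_. 0 :: 'b) x = 0"
    by (rule partials_eq_0) (simp add: fun_support_def)
qed

lemma zero_test_function [simp]: "(\<lambda>_. 0) \<in> test_functions \<Omega>" "(\<lambda>_. 0) \<in> test_functions_in \<Omega> K"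
  by (simp_all add: test_functions_in_def test_functions_def smooth_on_def fun_support_def)

lemma test_functions_in_partials_eq_0:
  assumes "f \<in> test_functions_in \<Omega> K" "x \<notin> K"
  shows "partials is f x = 0"
  using assms by (intro partials_eq_0) (auto simp: test_functions_in_def)

lemma test_functions_in_fun_support:
  "f \<in> test_functions \<Omega> \<Longrightarrow> f \<in> test_functions_in \<Omega> (fun_support f)"
  by (simp add: test_functions_in_def)

lemma topspace_DK_topology:
  fixes \<Omega> :: "(real^'n) set"
  assumes "closed K"
  shows "topspace (DK_topology \<Omega> K :: (real^'n \<Rightarrow> 'k::real_normed_field) topology) = test_functions_in \<Omega> K"
proof (rule antisym)
  show "topspace (DK_topology \<Omega> K :: (real^'n \<Rightarrow> 'k) topology) \<subseteq> test_functions_in \<Omega> K"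
    using openin_topspace[of "DK_topology \<Omega> K :: (real^'n \<Rightarrow> 'k) topology"] unfolding openin_DK_topology by (rule conjunct1)
  have "\<exists>W\<in>{DK_basic \<Omega> K m \<epsilon> |m \<epsilon>. 0 < \<epsilon>}. \<forall>w\<in>W. (\<lambda>x. f x + w x) \<in> test_functions_in \<Omega> K"
    if "f \<in> test_functions_in \<Omega> K" for f :: "real^'n \<Rightarrow> 'k"
  proof (intro bexI[of _ "DK_basic \<Omega> K 0 1"] ballI)
    fix w :: "real^'n \<Rightarrow> 'k" assume "w \<in> DK_basic \<Omega> K 0 1"
    then show "(\<lambda>x. f x + w x) \<in> test_functions_in \<Omega> K"
      using test_function_lincomb[OF that _ assms, of w 1 1] by (simp add: DK_basic_def)
  qed (use zero_less_one in blast)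
  then have "openin (DK_topology \<Omega> K) (test_functions_in \<Omega> K :: (real^'n \<Rightarrow> 'k) set)"
    by (simp add: openin_DK_topology)
  then show "test_functions_in \<Omega> K \<subseteq> topspace (DK_topology \<Omega> K :: (real^'n \<Rightarrow> 'k) topology)"
    by (rule openin_subset)
qed

section \<open>Weighted neighbourhoods of zero\<close>

text \<open>
  \<open>\<epsilon>\<close> may decay towards the boundary of \<open>\<Omega>\<close> or at infinity: a neighbourhood of 0 results if it is bounded below
  on each compact subset of \<open>\<Omega>\<close>.
\<close>

definition weighted_ball ::
    "(real^'n) set \<Rightarrow> 'n list \<Rightarrow> (real^'n) set \<Rightarrow> (real^'n \<Rightarrow> real) \<Rightarrow> (real^'n \<Rightarrow> 'k::real_normed_field) set"
  where "weighted_ball \<Omega> is S \<epsilon> = {f \<in> test_functions \<Omega>. \<forall>x\<in>S. norm (partials is f x) \<le> \<epsilon> x}"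

lemma absolutely_convex_weighted_ball:
  assumes "\<And>x. x \<in> S \<Longrightarrow> 0 < \<epsilon> x"
  shows "absolutely_convex (weighted_ball \<Omega> is S \<epsilon> :: (real^'n \<Rightarrow> 'k::real_normed_field) set)"
  unfolding absolutely_convex_def
proof (intro conjI ballI allI impI)
  have "(\<lambda>_. 0) \<in> (weighted_ball \<Omega> is S \<epsilon> :: (real^'n \<Rightarrow> 'k) set)"
    using less_imp_le[OF assms] by (simp add: weighted_ball_def)
  then show "weighted_ball \<Omega> is S \<epsilon> \<noteq> ({} :: (real^'n \<Rightarrow> 'k) set)" by blast
next
  fix f g :: "real^'n \<Rightarrow> 'k" and a b :: 'k
  assume f: "f \<in> weighted_ball \<Omega> is S \<epsilon>" and g: "g \<in> weighted_ball \<Omega> is S \<epsilon>"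
    and ab: "norm a + norm b \<le> 1"
  have fg: "f \<in> test_functions \<Omega>" "g \<in> test_functions \<Omega>"
    using f g by (auto simp: weighted_ball_def)
  have "norm (partials is (\<lambda>x. a * f x + b * g x) x) \<le> \<epsilon> x" if x: "x \<in> S" for x
  proof -
    have "norm (partials is (\<lambda>x. a * f x + b * g x) x)
        \<le> norm a * norm (partials is f x) + norm b * norm (partials is g x)"
      unfolding partials_test_lincomb[OF fg] by (metis norm_mult norm_triangle_ineq)
    also have "\<dots> \<le> norm a * \<epsilon> x + norm b * \<epsilon> x"
      using f g x by (intro add_mono mult_left_mono) (auto simp: weighted_ball_def)
    also have "\<dots> \<le> 1 * \<epsilon> x"
      using ab assms[OF x] by (simp only: distrib_right[symmetric]) (intro mult_right_mono, auto)
    finally show ?thesis by simp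
  qed
  then show "(\<lambda>x. a * f x + b * g x) \<in> weighted_ball \<Omega> is S \<epsilon>"
    using test_functions_lincomb[OF fg] by (simp add: weighted_ball_def)
qed

text \<open>For functions supported in \<open>K\<close> only the points of
  \<open>S \<inter> K\<close> impose a condition, and there the weight is at least some
  \<open>\<delta>\<close>. A bound on derivatives of order \<open>length is\<close> is therefore
  enough.\<close>

lemma weighted_ball_LF_base:
  assumes pos: "\<And>x. x \<in> S \<Longrightarrow> 0 < \<epsilon> x"
    and low: "\<And>K. compact K \<Longrightarrow> K \<subseteq> \<Omega> \<Longrightarrow> \<exists>\<delta>>0. \<forall>x\<in>S \<inter> K. \<delta> \<le> \<epsilon> x"
  shows "(weighted_ball \<Omega> is S \<epsilon> :: (real^'n \<Rightarrow> 'k::real_normed_field) set) \<in> LF_base \<Omega>"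
proof -
  let ?W = "weighted_ball \<Omega> is S \<epsilon> :: (real^'n \<Rightarrow> 'k) set"
  have "nbhd_of_zero (DK_topology \<Omega> K) (?W \<inter> test_functions_in \<Omega> K)" if K: "compact K" "K \<subseteq> \<Omega>" for K
  proof -
    obtain \<delta> where \<delta>: "\<delta> > 0" "\<And>x. x \<in> S \<inter> K \<Longrightarrow> \<delta> \<le> \<epsilon> x" using low[OF K] by blast
    have clK: "closed K" using K by (simp add: compact_imp_closed)
    \<comment> \<open>A uniform \<open>\<eta>\<close> below \<open>\<delta>\<close> leaves room for
      perturbations even if \<open>S \<inter> K\<close> is infinite; a pointwise strict bound need
      not.\<close>
    define U :: "(real^'n \<Rightarrow> 'k) set" where
      "U = {f \<in> test_functions_in \<Omega> K. \<exists>\<eta><\<delta>. \<forall>x\<in>S \<inter> K. norm (partials is f x) \<le> \<eta>}"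
    have "openin (DK_topology \<Omega> K) U"
      unfolding openin_DK_topology
    proof (intro conjI ballI)
      fix f assume "f \<in> U"
      then obtain \<eta> where f: "f \<in> test_functions_in \<Omega> K" and \<eta>: "\<eta> < \<delta>"
        "\<And>x. x \<in> S \<inter> K \<Longrightarrow> norm (partials is f x) \<le> \<eta>"
        by (auto simp: U_def)
      let ?B = "DK_basic \<Omega> K (length is) ((\<delta> - \<eta>) / 2)"
      have "(\<lambda>x. f x + w x) \<in> U" if w: "w \<in> ?B" for w
      proof -
        have wD: "w \<in> test_functions_in \<Omega> K" using w by (simp add: DK_basic_def)
        have "norm (partials is (\<lambda>x. f x + w x) x) \<le> (\<delta> + \<eta>) / 2" if x: "x \<in> S \<inter> K" for x
        proof -
          have "norm (partials is (\<lambda>x. f x + w x) x) \<le> norm (partials is f x) + norm (partials is w x)"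
            using partials_test_lincomb[of f \<Omega> w "is" 1 1 x] f wD norm_triangle_ineq
            by (simp add: test_functions_in_def)
          moreover have "norm (partials is w x) < (\<delta> - \<eta>) / 2"
            using w x by (simp add: DK_basic_def)
          ultimately show ?thesis using \<eta>(2)[OF x] by argo
        qed
        moreover have "(\<delta> + \<eta>) / 2 < \<delta>" using \<eta>(1) by simp
        moreover have "(\<lambda>x. f x + w x) \<in> test_functions_in \<Omega> K"
          using test_function_lincomb[OF f wD clK, of 1 1] by simp
        ultimately show ?thesis unfolding U_def by blast
      qed
      moreover have "0 < (\<delta> - \<eta>) / 2" using \<eta>(1) by simp
      ultimately show "\<exists>W\<in>{DK_basic \<Omega> K m \<epsilon> |m \<epsilon>. 0 < \<epsilon>}. \<forall>w\<in>W. (\<lambda>x. f x + w x) \<in> U"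
        by blast
    qed (auto simp: U_def)
    moreover have "(\<lambda>_. 0) \<in> U"
      using \<delta>(1) by (auto simp: U_def)
    moreover have "U \<subseteq> ?W \<inter> test_functions_in \<Omega> K"
    proof
      fix f assume "f \<in> U"
      then obtain \<eta> where f: "f \<in> test_functions_in \<Omega> K" and \<eta>: "\<eta> < \<delta>"
        "\<And>x. x \<in> S \<inter> K \<Longrightarrow> norm (partials is f x) \<le> \<eta>"
        by (auto simp: U_def)
      have "norm (partials is f x) \<le> \<epsilon> x" if "x \<in> S" for x
      proof (cases "x \<in> K")
        case True
        then show ?thesis using \<eta>(1) \<eta>(2)[of x] \<delta>(2)[of x] that by auto
      next
        case False
        then show ?thesis
          using test_functions_in_partials_eq_0[OF f False, of "is"] pos[OF that] by simp
      qed
      then show "f \<in> ?W \<inter> test_functions_in \<Omega> K"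
        using f by (auto simp: weighted_ball_def test_functions_in_def)
    qed
    moreover have "?W \<inter> test_functions_in \<Omega> K \<subseteq> topspace (DK_topology \<Omega> K)"
      by (simp add: topspace_DK_topology[OF clK])
    ultimately show ?thesis unfolding nbhd_of_zero_def by blast
  qed
  moreover have "?W \<subseteq> test_functions \<Omega>" by (auto simp: weighted_ball_def)
  ultimately show ?thesis
    using absolutely_convex_weighted_ball[OF pos] by (simp add: LF_base_def)
qed

lemma weighted_ball_const_LF_base: "0 < e \<Longrightarrow> weighted_ball \<Omega> is S (\<lambda>_. e) \<in> LF_base \<Omega>"
  by (rule weighted_ball_LF_base) auto

text \<open>Convergence is tested on open sets, so an open set inside the weighted ball is required.
  The factor \<open>\<eta> < 1\<close> leaves room for the ball with weight
  \<open>(1 - \<eta>) / 2 * \<epsilon> x\<close>, which again belongs to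
  \<open>LF_base\<close>.\<close>

lemma openin_weighted_ball_interior:
  assumes pos: "\<And>x. x \<in> S \<Longrightarrow> 0 < \<epsilon> x"
    and low: "\<And>K. compact K \<Longrightarrow> K \<subseteq> \<Omega> \<Longrightarrow> \<exists>\<delta>>0. \<forall>x\<in>S \<inter> K. \<delta> \<le> \<epsilon> x"
  shows "openin (test_topology \<Omega>)
    {f \<in> test_functions \<Omega>. \<exists>\<eta><1. \<forall>x\<in>S. norm (partials is f x :: 'k::real_normed_field) \<le> \<eta> * \<epsilon> x}"
    (is "openin _ ?P")
  unfolding openin_test_topology
proof (intro conjI ballI)
  fix f assume "f \<in> ?P"
  then obtain \<eta> where f: "f \<in> test_functions \<Omega>" and \<eta>: "\<eta> < 1"
    "\<And>x. x \<in> S \<Longrightarrow> norm (partials is f x) \<le> \<eta> * \<epsilon> x" by blast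
  let ?c = "(1 - \<eta>) / 2"
  have c: "0 < ?c" using \<eta>(1) by simp
  have "weighted_ball \<Omega> is S (\<lambda>x. ?c * \<epsilon> x) \<in> LF_base \<Omega>"
  proof (rule weighted_ball_LF_base)
    fix K assume "compact K" "K \<subseteq> \<Omega>"
    then obtain \<delta> where "\<delta> > 0" "\<forall>x\<in>S \<inter> K. \<delta> \<le> \<epsilon> x" using low by blast
    then show "\<exists>\<delta>>0. \<forall>x\<in>S \<inter> K. \<delta> \<le> ?c * \<epsilon> x"
      using c by (intro exI[of _ "?c * \<delta>"] conjI ballI mult_pos_pos mult_left_mono) auto
  qed (use pos c in \<open>auto intro: mult_pos_pos\<close>)
  moreover have "(\<lambda>x. f x + w x) \<in> ?P" if w: "w \<in> weighted_ball \<Omega> is S (\<lambda>x. ?c * \<epsilon> x)" for w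
  proof -
    have wD: "w \<in> test_functions \<Omega>" using w by (simp add: weighted_ball_def)
    have "norm (partials is (\<lambda>x. f x + w x) x) \<le> ((1 + \<eta>) / 2) * \<epsilon> x" if x: "x \<in> S" for x
    proof -
      have "norm (partials is (\<lambda>x. f x + w x) x) \<le> norm (partials is f x) + norm (partials is w x)"
        using partials_test_lincomb[OF f wD, of "is" 1 1 x] norm_triangle_ineq by simp
      also have "\<dots> \<le> \<eta> * \<epsilon> x + ?c * \<epsilon> x"
        using w x \<eta>(2) by (intro add_mono) (auto simp: weighted_ball_def)
      also have "\<dots> = ((1 + \<eta>) / 2) * \<epsilon> x" by (simp add: field_simps)
      finally show ?thesis .
    qed
    moreover have "(1 + \<eta>) / 2 < 1" using \<eta>(1) by simp
    moreover have "(\<lambda>x. f x + w x) \<in> test_functions \<Omega>"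
      using test_functions_lincomb[OF f wD, of 1 1] by simp
    ultimately show ?thesis by blast
  qed
  ultimately show "\<exists>W\<in>LF_base \<Omega>. \<forall>w\<in>W. (\<lambda>x. f x + w x) \<in> ?P" by blast
qed blast

lemma zero_weighted_ball_interior:
  "(\<lambda>_. 0) \<in> {f \<in> test_functions \<Omega>. \<exists>\<eta><1. \<forall>x\<in>S. norm (partials is f x :: 'k::real_normed_field) \<le> \<eta> * \<epsilon> x}"
  by (auto intro: exI[of _ 0])

lemma topspace_test_topology:
  fixes \<Omega> :: "(real^'n) set"
  shows "topspace (test_topology \<Omega> :: (real^'n \<Rightarrow> 'k::real_normed_field) topology) = test_functions \<Omega>"
proof (rule antisym)
  show "topspace (test_topology \<Omega> :: (real^'n \<Rightarrow> 'k) topology) \<subseteq> test_functions \<Omega>"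
    using openin_topspace[of "test_topology \<Omega> :: (real^'n \<Rightarrow> 'k) topology"] unfolding openin_test_topology by (rule conjunct1)
  \<comment> \<open>With no points to constrain, the open set of
    \<open>openin_weighted_ball_interior\<close> is the whole space.\<close>
  have "{f \<in> test_functions \<Omega>. \<exists>\<eta><1. \<forall>x\<in>{}. norm (partials [] f x :: 'k) \<le> \<eta> * 1} = test_functions \<Omega>"
    by (auto intro: exI[of _ 0])
  then have "openin (test_topology \<Omega>) (test_functions \<Omega> :: (real^'n \<Rightarrow> 'k) set)"
    using openin_weighted_ball_interior[of "{}" "\<lambda>_. 1" \<Omega> "[]", where 'k = 'k] gt_ex[of "0 :: real"] by simp
  then show "test_functions \<Omega> \<subseteq> topspace (test_topology \<Omega> :: (real^'n \<Rightarrow> 'k) topology)"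
    by (rule openin_subset)
qed

section \<open>Absorption and bounded sets of test functions\<close>

lemma partials_uniformly_bounded:
  assumes "\<And>is. \<exists>C. \<forall>f\<in>A. \<forall>x. norm (partials is f x) \<le> C"
  shows "\<exists>C>0. \<forall>is. length is \<le> m \<longrightarrow> (\<forall>f\<in>A. \<forall>x. norm (partials (is :: 'n::finite list) f x) \<le> C)"
proof -
  obtain C where C: "\<And>is f x. f \<in> A \<Longrightarrow> norm (partials is f x) \<le> C is" using assms by metis
  \<comment> \<open>Finitely many directions give finitely many lists up to a given length, so the
    separate bounds can be summed.\<close>
  let ?L = "{is :: 'n list. length is \<le> m}"
  have L: "finite ?L" using finite_lists_length_le[of "UNIV :: 'n set" m] by simp
  have "norm (partials is f x) \<le> 1 + (\<Sum>js\<in>?L. \<bar>C js\<bar>)" if "is \<in> ?L" "f \<in> A" for "is" f x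
  proof -
    have "norm (partials is f x) \<le> \<bar>C is\<bar>" using C[OF that(2), of "is" x] by simp
    also have "\<dots> \<le> (\<Sum>js\<in>?L. \<bar>C js\<bar>)" using L that by (intro member_le_sum) auto
    finally show ?thesis by simp
  qed
  moreover have "0 < 1 + (\<Sum>js\<in>?L. \<bar>C js\<bar>)" by (intro add_pos_nonneg sum_nonneg) auto
  ultimately show ?thesis by blast
qed

text \<open>On \<open>K\<close> the set \<open>W\<close> contains a basic neighbourhood, which
  restricts derivatives up to a finite order \<open>m\<close> only; all of these are bounded on
  \<open>A\<close> by a common constant, so small multiples of \<open>A\<close> fall into
  it.\<close>

lemma LF_base_absorbs:
  fixes A :: "(real^'n \<Rightarrow> 'k::real_normed_field) set"
  assumes K: "compact K" "K \<subseteq> \<Omega>" and A: "A \<subseteq> test_functions_in \<Omega> K"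
    and bdd: "\<And>is. \<exists>C. \<forall>f\<in>A. \<forall>x. norm (partials is f x) \<le> C"
    and W: "W \<in> LF_base \<Omega>"
  shows "\<exists>t>0. \<forall>f\<in>A. \<forall>c. norm c \<le> t \<longrightarrow> (\<lambda>x. c * f x) \<in> W"
proof -
  have "nbhd_of_zero (DK_topology \<Omega> K) (W \<inter> test_functions_in \<Omega> K)"
    using W K by (simp add: LF_base_def)
  then obtain U where U: "openin (DK_topology \<Omega> K) U" "(\<lambda>_. 0) \<in> U" "U \<subseteq> W"
    unfolding nbhd_of_zero_def by blast
  then obtain m \<epsilon> where \<epsilon>: "0 < \<epsilon>" and "\<forall>w\<in>DK_basic \<Omega> K m \<epsilon>. (\<lambda>x. 0 + w x) \<in> U"
    unfolding openin_DK_topology by blast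
  then have sub: "DK_basic \<Omega> K m \<epsilon> \<subseteq> W" using U(3) by auto
  obtain C where C: "C > 0" "\<And>is f x. length is \<le> m \<Longrightarrow> f \<in> A \<Longrightarrow> norm (partials is f x) \<le> C"
    using partials_uniformly_bounded[OF bdd, of m] by blast
  have "(\<lambda>x. c * f x) \<in> W" if f: "f \<in> A" and c: "norm c \<le> \<epsilon> / (2 * C)" for f c
  proof -
    have fK: "f \<in> test_functions_in \<Omega> K" using f A by blast
    then have fD: "f \<in> test_functions \<Omega>" by (simp add: test_functions_in_def)
    have "norm (partials is (\<lambda>x. c * f x) x) < \<epsilon>" if "length is \<le> m" for "is" x
    proof -
      have "norm (partials is (\<lambda>x. c * f x) x) = norm c * norm (partials is f x)"
        using partials_test_lincomb[OF fD fD, of "is" c 0 x] by (simp add: norm_mult)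
      also have "\<dots> \<le> \<epsilon> / (2 * C) * C"
        using c C(1) C(2)[OF that f] \<epsilon> by (intro mult_mono) auto
      also have "\<dots> < \<epsilon>" using C(1) \<epsilon> by simp
      finally show ?thesis .
    qed
    moreover have "(\<lambda>x. c * f x) \<in> test_functions_in \<Omega> K"
      using test_function_lincomb[OF fK fK compact_imp_closed[OF K(1)], of c 0] by simp
    ultimately show ?thesis using sub by (auto simp: DK_basic_def)
  qed
  moreover have "0 < \<epsilon> / (2 * C)" using \<epsilon> C(1) by simp
  ultimately show ?thesis by blast
qed

lemma LF_base_absorbs_point:
  fixes f :: "real^'n \<Rightarrow> 'k::real_normed_field"
  assumes "f \<in> test_functions \<Omega>" "W \<in> LF_base \<Omega>"
  shows "\<exists>t>0. \<forall>c. norm c \<le> t \<longrightarrow> (\<lambda>x. c * f x) \<in> W"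
proof -
  have "\<exists>t>0. \<forall>f\<in>{f}. \<forall>c. norm c \<le> t \<longrightarrow> (\<lambda>x. c * f x) \<in> W"
    by (rule LF_base_absorbs[of "fun_support f" \<Omega>])
      (use assms test_function_partials_bounded[OF assms(1)] in
        \<open>auto simp: test_functions_in_fun_support test_functions_def\<close>)
  then show ?thesis by simp
qed

text \<open>The source of all bounded sets used below: absorption of small multiples by
  \<open>c\<close> turns into inclusion in large multiples by passing to
  \<open>inverse c\<close>.\<close>

lemma vector_bounded_testI:
  fixes A :: "(real^'n \<Rightarrow> 'k::real_normed_field) set"
  assumes K: "compact K" "K \<subseteq> \<Omega>" and A: "A \<subseteq> test_functions_in \<Omega> K"
    and bdd: "\<And>is. \<exists>C. \<forall>f\<in>A. \<forall>x. norm (partials is f x) \<le> C"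
  shows "vector_bounded (test_topology \<Omega>) A"
  unfolding vector_bounded_def
proof (intro conjI allI impI)
  show "A \<subseteq> topspace (test_topology \<Omega>)"
    using A by (auto simp: topspace_test_topology test_functions_in_def)
  fix V :: "(real^'n \<Rightarrow> 'k) set" assume "nbhd_of_zero (test_topology \<Omega>) V"
  then obtain U where U: "openin (test_topology \<Omega>) U" "(\<lambda>_. 0) \<in> U" "U \<subseteq> V"
    unfolding nbhd_of_zero_def by blast
  then obtain W where W: "W \<in> LF_base \<Omega>" and "\<forall>w\<in>W. (\<lambda>x. 0 + w x) \<in> U"
    unfolding openin_test_topology by blast
  then have "W \<subseteq> V" using U(3) by auto
  obtain t where t: "t > 0" "\<And>f c. f \<in> A \<Longrightarrow> norm c \<le> t \<Longrightarrow> (\<lambda>x. c * f x) \<in> W"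
    using LF_base_absorbs[OF assms W] by blast
  have "A \<subseteq> (\<lambda>f x. c * f x) ` V" if c: "1 / t \<le> norm c" for c :: 'k
  proof
    fix f assume f: "f \<in> A"
    have "0 < norm c" using c t(1) by (meson less_le_trans zero_less_divide_1_iff)
    then have "norm (inverse c) \<le> t"
      using c t(1) by (simp only: norm_inverse) (simp add: field_simps)
    then have "(\<lambda>x. inverse c * f x) \<in> V" using t(2) f \<open>W \<subseteq> V\<close> by blast
    then show "f \<in> (\<lambda>f x. c * f x) ` V"
      by (rule image_eqI[rotated]) (use \<open>0 < norm c\<close> in \<open>simp add: mult.assoc[symmetric]\<close>)
  qed
  then show "\<exists>r>0. \<forall>c::'k. r \<le> norm c \<longrightarrow> A \<subseteq> (\<lambda>f x. c * f x) ` V"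
    using t(1) by (intro exI[of _ "1 / t"]) simp
qed

lemma vector_bounded_singleton:
  assumes "f \<in> test_functions \<Omega>"
  shows "vector_bounded (test_topology \<Omega>) {f}"
  by (rule vector_bounded_testI[of "fun_support f" \<Omega>])
    (use assms test_function_partials_bounded[OF assms] in
      \<open>auto simp: test_functions_in_fun_support test_functions_def\<close>)

text \<open>The functions whose derivative stays below 1 everywhere form a neighbourhood of 0, and a
  multiple of it by some \<open>r\<close> includes \<open>A\<close>; this \<open>r\<close> is the
  bound.\<close>

lemma vector_bounded_partials:
  fixes A :: "(real^'n \<Rightarrow> 'k::real_normed_field) set"
  assumes "vector_bounded (test_topology \<Omega>) A"
  shows "\<exists>C>0. \<forall>f\<in>A. \<forall>x. norm (partials is f x) \<le> C"
proof -
  let ?P = "{f \<in> test_functions \<Omega>. \<exists>\<eta><1. \<forall>x\<in>UNIV. norm (partials is f x :: 'k) \<le> \<eta> * 1}"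
  have P: "openin (test_topology \<Omega>) ?P"
    by (rule openin_weighted_ball_interior) (use zero_less_one in blast)+
  moreover have "(\<lambda>_. 0) \<in> ?P" by (rule zero_weighted_ball_interior)
  ultimately have "nbhd_of_zero (test_topology \<Omega>) ?P"
    unfolding nbhd_of_zero_def using openin_subset by blast
  then obtain r where r: "r > 0" "\<And>c::'k. r \<le> norm c \<Longrightarrow> A \<subseteq> (\<lambda>f x. c * f x) ` ?P"
    using assms unfolding vector_bounded_def by blast
  have "norm (partials is f x) \<le> r" if fA: "f \<in> A" for f x
  proof -
    obtain g \<eta> where g: "g \<in> test_functions \<Omega>" "f = (\<lambda>x. of_real r * g x)" "\<eta> < 1"
      "\<And>x. norm (partials is g x) \<le> \<eta> * 1"
    proof -
      have "f \<in> (\<lambda>f x. of_real r * f x) ` ?P" using r(2)[of "of_real r"] r(1) fA by auto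
      then show ?thesis using that by blast
    qed
    have "norm (partials is f x) = r * norm (partials is g x)"
      using partials_test_lincomb[OF g(1) g(1), of "is" "of_real r" 0 x] r(1)
      by (simp add: g(2) norm_mult)
    also have "\<dots> \<le> r * 1" using g(3) g(4)[of x] r(1) by (intro mult_left_mono) auto
    finally show ?thesis by simp
  qed
  then show ?thesis using r(1) by blast
qed

section \<open>Test functions with prescribed behaviour\<close>

lemma exists_test_bump:
  fixes a :: "real^'n"
  assumes "0 < r" "cball a r \<subseteq> \<Omega>"
  shows "\<exists>f :: real^'n \<Rightarrow> 'k::real_normed_field. f \<in> test_functions_in \<Omega> (cball a r) \<and> f a = 1"
  using bump_rescaled(1)[of "1 / r" a \<Omega> "1 / bump 0 :: 'k"] assms bump_zero
  by (intro exI[of _ "\<lambda>x. 1 / bump 0 * bump ((1 / r) *\<^sub>R (x - a))"]) simp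

text \<open>Compress the bump by a factor \<open>s\<close> and divide by \<open>s ^ n * C\<close>.
  Derivatives of order l then scale like s^(l - n): at most 1 up to order \<open>n\<close>, but
  growing linearly with \<open>s\<close> at order \<open>n + 1\<close>.\<close>

lemma exists_steep_test_function:
  fixes p :: "real^'n"
  assumes "0 < r" "cball p r \<subseteq> \<Omega>"
  shows "\<exists>g :: real^'n \<Rightarrow> 'k::real_normed_field. g \<in> test_functions_in \<Omega> (cball p r) \<and>
    (\<forall>is. length is \<le> n \<longrightarrow> (\<forall>x. norm (partials is g x) \<le> 1)) \<and>
    (\<exists>y. M < norm (partials (replicate (Suc n) i) g y))"
proof -
  let ?b = "bump :: real^'n \<Rightarrow> 'k"
  have "?b \<in> test_functions UNIV"
    using bump_rescaled(1)[of 1 "0 :: real^'n" UNIV "1 :: 'k"] by (simp add: test_functions_in_def)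
  then have "\<exists>C. \<forall>f\<in>{?b}. \<forall>x. norm (partials is f x) \<le> C" for "is"
    using test_function_partials_bounded by blast
  from partials_uniformly_bounded[OF this, of n]
  obtain C where C: "C > 0" "\<And>is x. length is \<le> n \<Longrightarrow> norm (partials is ?b x) \<le> C" by auto
  obtain z where z: "partials (replicate (Suc n) i) ?b z \<noteq> 0"
    using partials_replicate_bump_nonzero by blast
  define d where "d = norm (partials (replicate (Suc n) i) ?b z)"
  have d: "d > 0" using z by (simp add: d_def)
  \<comment> \<open>The bound 1 makes the powers of \<open>s\<close> monotone, \<open>1 / r\<close>
    fits the support into the ball, and the last term gives \<open>s * d / C\<close> a value of at
    least \<open>\<bar>M\<bar> + 1\<close>.\<close>
  define s where "s = max (max 1 (1 / r)) ((\<bar>M\<bar> + 1) * C / d)"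
  have s: "1 \<le> s" "1 / r \<le> s" "(\<bar>M\<bar> + 1) * C / d \<le> s" by (auto simp: s_def)
  have sr: "1 / s \<le> r" using s assms(1) by (simp add: field_simps)
  define c :: 'k where "c = of_real (1 / (s ^ n * C))"
  have nc: "norm c = 1 / (s ^ n * C)" using s(1) C(1) unfolding c_def by (simp add: norm_divide norm_mult norm_power)
  let ?g = "\<lambda>x. c * ?b (s *\<^sub>R (x - p))"
  have sub: "cball p (1 / s) \<subseteq> cball p r" using sr by (rule subset_cball)
  have pos: "0 < s" "cball p (1 / s) \<subseteq> \<Omega>" using s(1) sub assms(2) by auto
  have "?g \<in> test_functions_in \<Omega> (cball p r)"
    using bump_rescaled(1)[OF pos, of c] sub by (auto simp: test_functions_in_def)
  moreover have g: "norm (partials is ?g x) = s ^ length is / (s ^ n * C) * norm (partials is ?b (s *\<^sub>R (x - p)))"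
    for "is" x
    unfolding bump_rescaled(2)[OF pos] norm_mult nc using pos(1) by simp
  have "norm (partials is ?g x) \<le> 1" if "length is \<le> n" for "is" x
  proof -
    have "norm (partials is ?g x) \<le> s ^ length is / (s ^ n * C) * C"
      unfolding g using C pos(1) that by (intro mult_left_mono) auto
    also have "\<dots> = s ^ length is / s ^ n" using C(1) by simp
    also have "\<dots> \<le> 1" using power_increasing[OF that s(1)] pos(1) by simp
    finally show ?thesis .
  qed
  \<comment> \<open>The point is the one that the rescaling maps to \<open>z\<close>.\<close>
  moreover have "M < norm (partials (replicate (Suc n) i) ?g (p + (1 / s) *\<^sub>R z))"
  proof -
    have "(\<bar>M\<bar> + 1) * C \<le> s * d" using s(3) d by (simp add: field_simps)
    then have "M * C < s * d" using C(1) by (smt (verit) mult_right_mono mult_less_cancel_right_pos)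
    then have "M < s * d / C" using C(1) by (simp add: field_simps)
    also have "\<dots> = norm (partials (replicate (Suc n) i) ?g (p + (1 / s) *\<^sub>R z))"
      unfolding g using pos(1) by (simp add: d_def)
    finally show ?thesis .
  qed
  ultimately show ?thesis by blast
qed

section \<open>The space of test functions\<close>

text \<open>Were \<open>\<Omega>\<close> compact, it would be clopen and bounded, contradicting
  connectedness of the space. Hence some sequence in \<open>\<Omega>\<close> has no subsequence
  converging in \<open>\<Omega>\<close>, so no compact subset can catch infinitely many of its
  terms.\<close>

lemma escaping_sequence:
  fixes \<Omega> :: "(real^'n) set"
  assumes "open \<Omega>" "\<Omega> \<noteq> {}"
  shows "\<exists>X :: nat \<Rightarrow> real^'n. range X \<subseteq> \<Omega> \<and> (\<forall>K. compact K \<longrightarrow> K \<subseteq> \<Omega> \<longrightarrow> finite {n. X n \<in> K})"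
proof -
  have "\<not> compact \<Omega>"
    using assms clopen[of \<Omega>] not_bounded_UNIV compact_eq_bounded_closed by metis
  then obtain X :: "nat \<Rightarrow> real^'n" where X: "\<And>n. X n \<in> \<Omega>"
    and div: "\<And>l r. l \<in> \<Omega> \<Longrightarrow> strict_mono r \<Longrightarrow> \<not> (X \<circ> r) \<longlonglongrightarrow> l"
    unfolding compact_def by blast
  have "finite {n. X n \<in> K}" if K: "compact K" "K \<subseteq> \<Omega>" for K
  proof (rule ccontr)
    assume "infinite {n. X n \<in> K}"
    then obtain r :: "nat \<Rightarrow> nat" where r: "strict_mono r" "\<And>n. r n \<in> {n. X n \<in> K}"
      using infinite_enumerate by blast
    then obtain l r' where l: "l \<in> K" "strict_mono (r' :: nat \<Rightarrow> nat)" "((X \<circ> r) \<circ> r') \<longlonglongrightarrow> l"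
      using K(1) unfolding compact_def by (metis (mono_tags, lifting) comp_apply mem_Collect_eq)
    then show False
      using div[of l "r \<circ> r'"] r(1) K(2) by (auto simp: strict_mono_o comp_assoc)
  qed
  then show ?thesis using X by blast
qed

lemma kappa_Frechet_UrysohnD:
  assumes "kappa_Frechet_Urysohn T" "openin T U" "x \<in> T closure_of U"
  shows "\<exists>\<sigma>::nat \<Rightarrow> 'a. range \<sigma> \<subseteq> U \<and> limitin T \<sigma> x sequentially"
  using assms unfolding kappa_Frechet_Urysohn_def by blast

lemma limitin_eventually_mem:
  "limitin T \<sigma> z sequentially \<Longrightarrow> openin T P \<Longrightarrow> z \<in> P \<Longrightarrow> \<forall>\<^sub>F k in sequentially. \<sigma> k \<in> P"
  by (simp add: limitin_def)

lemma finite_nat_if_eventually_not: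
  "\<forall>\<^sub>F k in sequentially. \<not> P k \<Longrightarrow> finite {k. P k}"
  by (simp add: cofinite_eq_sequentially[symmetric] eventually_cofinite)

text \<open>For a fixed \<open>n\<close> both conditions are open conditions on the values at just
  two points, \<open>p\<close> and \<open>X n\<close>.\<close>

lemma openin_escaping_test_set:
  fixes p :: "real^'n"
  shows "openin (test_topology \<Omega>)
    {f \<in> test_functions \<Omega>. \<exists>n. X n \<noteq> p \<and> 1 / (real n + 1) < norm (f p) \<and> f (X n) \<noteq> (0::'k::real_normed_field)}"
    (is "openin _ ?U")
  unfolding openin_test_topology
proof (intro conjI ballI)
  fix f assume "f \<in> ?U"
  then obtain n where f: "f \<in> test_functions \<Omega>" and n: "X n \<noteq> p" "1 / (real n + 1) < norm (f p)" "f (X n) \<noteq> 0"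
    by blast
  define a where "a = 1 / (real n + 1)"
  \<comment> \<open>Half of each gap: the value at \<open>p\<close> keeps above the threshold and
    the value at \<open>X n\<close> cannot be cancelled.\<close>
  define e where "e = min ((norm (f p) - a) / 2) (norm (f (X n)) / 2)"
  have e: "0 < e" using n by (simp add: e_def a_def)
  have e_le: "e \<le> (norm (f p) - a) / 2" "e \<le> norm (f (X n)) / 2"
    unfolding e_def by (rule min.cobounded1 min.cobounded2)+
  have "(\<lambda>x. f x + w x) \<in> ?U" if w: "w \<in> weighted_ball \<Omega> [] {p, X n} (\<lambda>_. e)" for w
  proof -
    have wD: "w \<in> test_functions \<Omega>" and wp: "norm (w p) \<le> e" and wX: "norm (w (X n)) \<le> e"
      using w by (auto simp: weighted_ball_def)
    have "norm (f p) \<le> norm (f p + w p) + norm (w p)"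
      using norm_triangle_ineq4[of "f p + w p" "w p"] by simp
    then have "1 / (real n + 1) < norm (f p + w p)"
      using wp e e_le(1) unfolding a_def[symmetric] by argo
    moreover have "f (X n) + w (X n) \<noteq> 0"
    proof
      assume "f (X n) + w (X n) = 0"
      then have "norm (f (X n)) = norm (w (X n))" by (metis add_eq_0_iff norm_minus_cancel)
      then show False using wX e e_le(2) by linarith
    qed
    moreover have "(\<lambda>x. f x + w x) \<in> test_functions \<Omega>"
      using test_functions_lincomb[OF f wD, of 1 1] by simp
    ultimately show ?thesis using n(1) by blast
  qed
  then show "\<exists>W\<in>LF_base \<Omega>. \<forall>w\<in>W. (\<lambda>x. f x + w x) \<in> ?U"
    using weighted_ball_const_LF_base[OF e] by blast
qed blast

text \<open>The order of choices matters: first the height \<open>t\<close> that \<open>W\<close>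
  admits at \<open>p\<close>, then \<open>n\<close> large enough for \<open>t\<close>, and only then
  a multiple of a bump at \<open>X n\<close>, as small as \<open>W\<close> demands. Absolute
  convexity of \<open>W\<close> combines the two.\<close>

lemma zero_in_closure_of_escaping_test_set:
  fixes p :: "real^'n"
  assumes "open \<Omega>" "p \<in> \<Omega>" "range X \<subseteq> \<Omega>" and finp: "finite {n. X n = p}"
  shows "(\<lambda>_. 0) \<in> test_topology \<Omega> closure_of
    {f \<in> test_functions \<Omega>. \<exists>n. X n \<noteq> p \<and> 1 / (real n + 1) < norm (f p) \<and> f (X n) \<noteq> (0::'k::real_normed_field)}"
    (is "_ \<in> _ closure_of ?U")
  unfolding in_closure_of
proof (intro conjI allI impI)
  show "(\<lambda>_. 0) \<in> topspace (test_topology \<Omega> :: (real^'n \<Rightarrow> 'k) topology)"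
    by (simp add: topspace_test_topology)
  fix T :: "(real^'n \<Rightarrow> 'k) set"
  assume "(\<lambda>_. 0) \<in> T \<and> openin (test_topology \<Omega>) T"
  then obtain W where W: "W \<in> LF_base \<Omega>" and "\<forall>w\<in>W. (\<lambda>x. 0 + w x) \<in> T"
    unfolding openin_test_topology by blast
  then have WT: "W \<subseteq> T" by auto
  have conv: "(\<lambda>x. a * f x + b * g x) \<in> W" if "f \<in> W" "g \<in> W" "norm a + norm b \<le> 1" for f g a b
    using W that by (auto simp: LF_base_def absolutely_convex_def)
  obtain r where "0 < r" "cball p r \<subseteq> \<Omega>" using assms(1,2) open_contains_cball by blast
  then obtain \<phi> :: "real^'n \<Rightarrow> 'k" where \<phi>: "\<phi> \<in> test_functions \<Omega>" "\<phi> p = 1"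
    using exists_test_bump[of r p \<Omega>, where 'k = 'k] by (auto simp: test_functions_in_def)
  obtain t where t: "0 < t" "(\<lambda>x. of_real t * \<phi> x) \<in> W"
    using LF_base_absorbs_point[OF \<phi>(1) W] by (metis norm_of_real abs_of_pos order_refl)
  obtain n0 where n0: "inverse (real (Suc n0)) < t / 2" using reals_Archimedean[of "t / 2"] t(1) by auto
  have "finite ({n. X n = p} \<union> {..n0})" using finp by simp
  then obtain n where n: "n \<notin> {n. X n = p} \<union> {..n0}" using ex_new_if_finite[OF infinite_UNIV_nat] by blast
  have "1 / (real n + 1) < t / 2"
  proof -
    have "1 / (real n + 1) \<le> inverse (real (Suc n0))" using n by (simp add: field_simps)
    then show ?thesis using n0 by linarith
  qed
  \<comment> \<open>The second bump lives off \<open>p\<close>, so that it leaves the value at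
    \<open>p\<close> unchanged.\<close>
  have "X n \<in> \<Omega> - {p}" using assms(3) n by auto
  then obtain s where s: "0 < s" "cball (X n) s \<subseteq> \<Omega> - {p}"
    using assms(1) open_contains_cball[of "\<Omega> - {p}"] by (metis open_Diff closed_singleton)
  then obtain \<psi> :: "real^'n \<Rightarrow> 'k" where \<psi>: "\<psi> \<in> test_functions_in \<Omega> (cball (X n) s)" "\<psi> (X n) = 1"
    using exists_test_bump[of s "X n" \<Omega>, where 'k = 'k] by auto
  have "p \<notin> cball (X n) s" using s(2) by blast
  from test_functions_in_partials_eq_0[OF \<psi>(1) this, of "[]"] have \<psi>p: "\<psi> p = 0" by simp
  have \<psi>D: "\<psi> \<in> test_functions \<Omega>" using \<psi>(1) by (simp add: test_functions_in_def)
  obtain u where u: "0 < u" "(\<lambda>x. of_real u * \<psi> x) \<in> W"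
    using LF_base_absorbs_point[OF \<psi>D W] by (metis norm_of_real abs_of_pos order_refl)
  \<comment> \<open>The second bump is added only if the first one vanishes at \<open>X n\<close>;
    this rules out cancellation.\<close>
  define b :: 'k where "b = (if \<phi> (X n) = 0 then 1 / 2 else 0)"
  define f where "f = (\<lambda>x. (1 / 2) * (of_real t * \<phi> x) + b * (of_real u * \<psi> x))"
  have "f \<in> W" unfolding f_def using t(2) u(2)
    by (rule conv) (simp add: b_def norm_divide)
  moreover have "norm (f p) = t / 2"
    using t(1) by (simp add: f_def \<phi>(2) \<psi>p norm_divide norm_mult)
  moreover have "f (X n) \<noteq> 0"
    using t(1) u(1) by (simp add: f_def b_def \<psi>(2))
  moreover have "f \<in> test_functions \<Omega>" using \<open>f \<in> W\<close> W by (auto simp: LF_base_def)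
  ultimately show "\<exists>y. y \<in> ?U \<and> y \<in> T"
    using WT n \<open>1 / (real n + 1) < t / 2\<close> by (intro exI[of _ f]) auto
qed

lemma test_topology_not_kappa_Frechet_Urysohn:
  fixes \<Omega> :: "(real^'n) set"
  assumes "open \<Omega>" "\<Omega> \<noteq> {}"
  shows "\<not> kappa_Frechet_Urysohn (test_topology \<Omega> :: (real^'n \<Rightarrow> 'k::real_normed_field) topology)"
proof
  assume kFU: "kappa_Frechet_Urysohn (test_topology \<Omega> :: (real^'n \<Rightarrow> 'k) topology)"
  obtain X :: "nat \<Rightarrow> real^'n" where X: "range X \<subseteq> \<Omega>" and fin: "\<And>K. compact K \<Longrightarrow> K \<subseteq> \<Omega> \<Longrightarrow> finite {n. X n \<in> K}"
    using escaping_sequence[OF assms] by metis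
  obtain p where p: "p \<in> \<Omega>" using assms(2) by (meson ex_in_conv)
  let ?U = "{f \<in> test_functions \<Omega>. \<exists>n. X n \<noteq> p \<and> 1 / (real n + 1) < norm (f p) \<and> f (X n) \<noteq> (0::'k)}"
  have "finite {n. X n = p}" using fin[of "{p}"] p by simp
  then have "(\<lambda>_. 0) \<in> test_topology \<Omega> closure_of ?U"
    by (rule zero_in_closure_of_escaping_test_set[OF assms(1) p X])
  then obtain \<sigma> :: "nat \<Rightarrow> real^'n \<Rightarrow> 'k" where \<sigma>: "range \<sigma> \<subseteq> ?U"
    and lim: "limitin (test_topology \<Omega>) \<sigma> (\<lambda>_. 0) sequentially"
    using kappa_Frechet_UrysohnD[OF kFU openin_escaping_test_set] by blast
  have "\<exists>n. 1 / (real n + 1) < norm (\<sigma> k p) \<and> \<sigma> k (X n) \<noteq> 0" for k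
  proof -
    have "\<sigma> k \<in> ?U" using \<sigma> by blast
    then show ?thesis by blast
  qed
  then obtain \<nu> where \<nu>: "\<And>k. 1 / (real (\<nu> k) + 1) < norm (\<sigma> k p)" "\<And>k. \<sigma> k (X (\<nu> k)) \<noteq> 0"
    by metis
  \<comment> \<open>Eventually \<open>norm (\<sigma> k p)\<close> is below
    \<open>1 / (real n + 1)\<close>, which excludes \<open>n\<close> as a witness.\<close>
  have fin_\<nu>: "finite {k. \<nu> k = n}" for n
  proof (rule finite_nat_if_eventually_not)
    let ?\<epsilon> = "1 / (real n + 1)"
    let ?P = "{f \<in> test_functions \<Omega>. \<exists>\<eta><1. \<forall>x\<in>{p}. norm (partials [] f x :: 'k) \<le> \<eta> * ?\<epsilon>}"
    have \<epsilon>: "0 < ?\<epsilon>" by simp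
    have "openin (test_topology \<Omega>) ?P"
      by (rule openin_weighted_ball_interior) (use \<epsilon> in blast)+
    from limitin_eventually_mem[OF lim this zero_weighted_ball_interior]
    show "\<forall>\<^sub>F k in sequentially. \<nu> k \<noteq> n"
    proof eventually_elim
      case (elim k)
      then obtain \<eta> where "\<eta> < 1" "norm (\<sigma> k p) \<le> \<eta> * ?\<epsilon>" by auto
      then have "norm (\<sigma> k p) < 1 * ?\<epsilon>" using mult_strict_right_mono[OF _ \<epsilon>] by (meson le_less_trans)
      then show ?case using \<nu>(1)[of k] by auto
    qed
  qed
  \<comment> \<open>The sequence \<open>X\<close> may repeat values, so the constraints are counted
    by points and not by indices.\<close>
  have fin_y: "finite {k. X (\<nu> k) = y}" if "y \<in> \<Omega>" for y
  proof -
    have "finite {n. X n = y}" using fin[of "{y}"] that by simp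
    then have "finite (\<Union>n\<in>{n. X n = y}. {k. \<nu> k = n})" using fin_\<nu> by blast
    moreover have "{k. X (\<nu> k) = y} = (\<Union>n\<in>{n. X n = y}. {k. \<nu> k = n})" by blast
    ultimately show ?thesis by simp
  qed
  \<comment> \<open>The least value at \<open>y\<close> among the finitely many
    \<open>\<sigma> k\<close> whose witness point is \<open>y\<close>; the inserted 1 covers the
    case that there are none.\<close>
  define \<epsilon> where "\<epsilon> y = Min (insert 1 ((\<lambda>k. norm (\<sigma> k y)) ` {k. X (\<nu> k) = y}))" for y
  have pos: "0 < \<epsilon> y" if "y \<in> \<Omega>" for y
    using fin_y[OF that] \<nu>(2) by (auto simp: \<epsilon>_def)
  let ?P = "{f \<in> test_functions \<Omega>. \<exists>\<eta><1. \<forall>x\<in>range X. norm (partials [] f x :: 'k) \<le> \<eta> * \<epsilon> x}"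
  have "openin (test_topology \<Omega>) ?P"
  proof (rule openin_weighted_ball_interior)
    fix K assume K: "compact K" "K \<subseteq> \<Omega>"
    have "range X \<inter> K \<subseteq> X ` {n. X n \<in> K}" by blast
    then have finK: "finite (range X \<inter> K)" using fin[OF K] finite_surj by blast
    \<comment> \<open>Only finitely many points of the sequence lie in \<open>K\<close>, so the
      weight has a positive minimum there.\<close>
    have "0 < Min (insert 1 (\<epsilon> ` (range X \<inter> K)))" using finK pos X by auto
    moreover have "\<forall>x\<in>range X \<inter> K. Min (insert 1 (\<epsilon> ` (range X \<inter> K))) \<le> \<epsilon> x"
      using finK by (intro ballI Min_le) auto
    ultimately show "\<exists>\<delta>>0. \<forall>x\<in>range X \<inter> K. \<delta> \<le> \<epsilon> x" by blast
  qed (use pos X in blast)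
  from eventually_happens'[OF sequentially_bot limitin_eventually_mem[OF lim this zero_weighted_ball_interior]]
  obtain k where "\<sigma> k \<in> ?P" by blast
  then obtain \<eta> where \<eta>: "\<eta> < 1" "norm (\<sigma> k (X (\<nu> k))) \<le> \<eta> * \<epsilon> (X (\<nu> k))" by auto
  have y: "X (\<nu> k) \<in> \<Omega>" using X by blast
  \<comment> \<open>At its own witness point \<open>\<sigma> k\<close> would be smaller than a
    minimum in which it takes part.\<close>
  have "norm (\<sigma> k (X (\<nu> k))) < 1 * \<epsilon> (X (\<nu> k))"
    using \<eta> mult_strict_right_mono[OF \<eta>(1) pos[OF y]] by linarith
  moreover have "\<epsilon> (X (\<nu> k)) \<le> norm (\<sigma> k (X (\<nu> k)))"
    unfolding \<epsilon>_def using fin_y[OF y] by (intro Min_le) auto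
  ultimately show False by simp
qed

section \<open>The strong dual\<close>

text \<open>Up to sign a derivative of the Dirac measure at \<open>x\<close>; the value 0 off the
  test functions is the convention of \<open>distributions\<close>.\<close>

definition partial_at :: "(real^'n) set \<Rightarrow> 'n list \<Rightarrow> real^'n \<Rightarrow> (real^'n \<Rightarrow> 'k::real_normed_field) \<Rightarrow> 'k"
  where "partial_at \<Omega> is x f = (if f \<in> test_functions \<Omega> then partials is f x else 0)"

lemma partial_at_distribution:
  fixes x :: "real^'n"
  shows "(partial_at \<Omega> is x :: (real^'n \<Rightarrow> 'k::real_normed_field) \<Rightarrow> 'k) \<in> distributions \<Omega>"
proof -
  let ?u = "partial_at \<Omega> is x :: (real^'n \<Rightarrow> 'k) \<Rightarrow> 'k"
  have "openin (test_topology \<Omega>) {f \<in> test_functions \<Omega>. ?u f \<in> S}" if "open S" for S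
    unfolding openin_test_topology
  proof (intro conjI ballI)
    fix f assume "f \<in> {f \<in> test_functions \<Omega>. ?u f \<in> S}"
    then have f: "f \<in> test_functions \<Omega>" "partials is f x \<in> S" by (auto simp: partial_at_def)
    obtain e where e: "0 < e" "cball (partials is f x) e \<subseteq> S"
      using \<open>open S\<close> f(2) open_contains_cball by blast
    have "(\<lambda>x. f x + w x) \<in> {f \<in> test_functions \<Omega>. ?u f \<in> S}" if w: "w \<in> weighted_ball \<Omega> is {x} (\<lambda>_. e)" for w
    proof -
      have wD: "w \<in> test_functions \<Omega>" and "norm (partials is w x) \<le> e"
        using w by (auto simp: weighted_ball_def)
      then have "partials is f x + partials is w x \<in> S"
        using e(2) by (auto simp: dist_norm)
      then show ?thesis
        using test_functions_lincomb[OF f(1) wD, of 1 1] partials_test_lincomb[OF f(1) wD, of "is" 1 1 x]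
        by (simp add: partial_at_def)
    qed
    then show "\<exists>W\<in>LF_base \<Omega>. \<forall>w\<in>W. (\<lambda>x. f x + w x) \<in> {f \<in> test_functions \<Omega>. ?u f \<in> S}"
      using weighted_ball_const_LF_base[OF e(1)] by blast
  qed blast
  then have "continuous_map (test_topology \<Omega>) euclidean ?u"
    by (simp add: continuous_map_def topspace_test_topology)
  then show ?thesis
    by (simp add: distributions_def partial_at_def test_functions_lincomb partials_test_lincomb)
qed

lemma distributions_lincomb:
  fixes u v :: "(real^'n \<Rightarrow> 'k::real_normed_field) \<Rightarrow> 'k"
  assumes "u \<in> distributions \<Omega>" "v \<in> distributions \<Omega>"
  shows "(\<lambda>f. a * u f + b * v f) \<in> distributions \<Omega>"
proof -
  have "continuous_map (test_topology \<Omega>) euclidean (\<lambda>f. c * w f)"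
    if "w \<in> distributions \<Omega>" for c and w :: "(real^'n \<Rightarrow> 'k) \<Rightarrow> 'k"
  proof -
    have "continuous_map euclidean euclidean ((*) c)" by (simp add: continuous_on_mult_left)
    then show ?thesis
      using that continuous_map_compose[of "test_topology \<Omega>" euclidean w euclidean "(*) c"]
      by (simp add: distributions_def comp_def)
  qed
  then have "continuous_map (test_topology \<Omega>) euclidean (\<lambda>f. a * u f + b * v f)"
    using assms by (intro continuous_map_add)
  then show ?thesis
    using assms by (auto simp: distributions_def algebra_simps)
qed

lemma distributions_add:
  fixes u v :: "(real^'n \<Rightarrow> 'k::real_normed_field) \<Rightarrow> 'k"
  assumes "u \<in> distributions \<Omega>" "v \<in> distributions \<Omega>"
  shows "(\<lambda>f. u f + v f) \<in> distributions \<Omega>"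
  using distributions_lincomb[OF assms, of 1 1] by simp

lemma zero_distribution: "(\<lambda>_. 0) \<in> distributions \<Omega>"
  using distributions_lincomb[OF partial_at_distribution partial_at_distribution, of 0 _ _ _ 0] by simp

text \<open>As for weighted balls, a uniform bound \<open>\<eta> < \<epsilon>\<close> keeps room for
  perturbations over an infinite set \<open>A\<close>.\<close>

lemma openin_strong_basic_interior:
  fixes A :: "(real^'n \<Rightarrow> 'k::real_normed_field) set"
  assumes A: "vector_bounded (test_topology \<Omega>) A"
  shows "openin (distribution_topology \<Omega>) {u \<in> distributions \<Omega>. \<exists>\<eta><\<epsilon>. \<forall>f\<in>A. norm (u f) \<le> \<eta>}"
    (is "openin _ ?P")
  unfolding openin_distribution_topology
proof (intro conjI ballI)
  fix u assume "u \<in> ?P"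
  then obtain \<eta> where u: "u \<in> distributions \<Omega>" and \<eta>: "\<eta> < \<epsilon>" "\<And>f. f \<in> A \<Longrightarrow> norm (u f) \<le> \<eta>" by blast
  have "(\<lambda>f. u f + w f) \<in> ?P" if w: "w \<in> strong_basic \<Omega> A ((\<epsilon> - \<eta>) / 2)" for w
  proof -
    have wD: "w \<in> distributions \<Omega>" using w by (simp add: strong_basic_def)
    have "norm (u f + w f) \<le> (\<epsilon> + \<eta>) / 2" if "f \<in> A" for f
    proof -
      have "norm (w f) < (\<epsilon> - \<eta>) / 2" using w that by (simp add: strong_basic_def)
      then show ?thesis using \<eta>(2)[OF that] norm_triangle_ineq[of "u f" "w f"] by argo
    qed
    moreover have "(\<epsilon> + \<eta>) / 2 < \<epsilon>" using \<eta>(1) by simp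
    ultimately show ?thesis using distributions_add[OF u wD] by blast
  qed
  moreover have "0 < (\<epsilon> - \<eta>) / 2" using \<eta>(1) by simp
  ultimately show "\<exists>W\<in>{strong_basic \<Omega> A \<epsilon> |A \<epsilon>. vector_bounded (test_topology \<Omega>) A \<and> 0 < \<epsilon>}.
      \<forall>w\<in>W. (\<lambda>f. u f + w f) \<in> ?P"
    using A by blast
qed blast

lemma zero_strong_basic_interior:
  "0 < \<epsilon> \<Longrightarrow> (\<lambda>_. 0) \<in> {u \<in> distributions \<Omega>. \<exists>\<eta><\<epsilon>. \<forall>f\<in>A. norm (u f) \<le> \<eta>}"
  using zero_distribution by auto

lemma topspace_distribution_topology:
  fixes \<Omega> :: "(real^'n) set"
  shows "topspace (distribution_topology \<Omega> :: ((real^'n \<Rightarrow> 'k::real_normed_field) \<Rightarrow> 'k) topology) = distributions \<Omega>"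
proof (rule antisym)
  show "topspace (distribution_topology \<Omega> :: ((real^'n \<Rightarrow> 'k) \<Rightarrow> 'k) topology) \<subseteq> distributions \<Omega>"
    using openin_topspace[of "distribution_topology \<Omega> :: ((real^'n \<Rightarrow> 'k) \<Rightarrow> 'k) topology"]
    unfolding openin_distribution_topology by (rule conjunct1)
  have "vector_bounded (test_topology \<Omega>) ({} :: (real^'n \<Rightarrow> 'k) set)"
    by (auto simp: vector_bounded_def intro: exI[of _ 1])
  from openin_strong_basic_interior[OF this, of 1]
  have "openin (distribution_topology \<Omega>) (distributions \<Omega> :: ((real^'n \<Rightarrow> 'k) \<Rightarrow> 'k) set)"
    using lt_ex[of "1 :: real"] by simp
  then show "distributions \<Omega> \<subseteq> topspace (distribution_topology \<Omega> :: ((real^'n \<Rightarrow> 'k) \<Rightarrow> 'k) topology)"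
    by (rule openin_subset)
qed

lemma openin_steep_distribution_set:
  fixes f0 :: "real^'n \<Rightarrow> 'k::real_normed_field"
  assumes f0: "f0 \<in> test_functions \<Omega>" and g: "\<And>n m. g n m \<in> test_functions \<Omega>"
  shows "openin (distribution_topology \<Omega>)
    {u \<in> distributions \<Omega>. \<exists>n m. 1 / (real n + 1) < norm (u f0) \<and> 1 < norm (u (g n m))}"
    (is "openin _ ?U")
  unfolding openin_distribution_topology
proof (intro conjI ballI)
  fix u assume "u \<in> ?U"
  then obtain n m where u: "u \<in> distributions \<Omega>" and nm: "1 / (real n + 1) < norm (u f0)" "1 < norm (u (g n m))"
    by blast
  define e where "e = min (norm (u f0) - 1 / (real n + 1)) (norm (u (g n m)) - 1)"
  have e: "0 < e" using nm by (simp add: e_def)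
  let ?A = "{f0} \<union> {g n m}"
  have "vector_bounded (test_topology \<Omega>) ?A"
    using f0 g by (intro vector_bounded_Un vector_bounded_singleton)
  moreover have "(\<lambda>f. u f + w f) \<in> ?U" if w: "w \<in> strong_basic \<Omega> ?A e" for w
  proof -
    have wD: "w \<in> distributions \<Omega>" and "norm (w f0) < e" "norm (w (g n m)) < e"
      using w by (auto simp: strong_basic_def)
    then have "1 / (real n + 1) < norm (u f0 + w f0)" "1 < norm (u (g n m) + w (g n m))"
      using norm_triangle_ineq4[of "u f0 + w f0" "w f0"]
        norm_triangle_ineq4[of "u (g n m) + w (g n m)" "w (g n m)"]
      by (simp_all add: e_def)
    then show ?thesis using distributions_add[OF u wD] by blast
  qed
  ultimately show "\<exists>W\<in>{strong_basic \<Omega> A \<epsilon> |A \<epsilon>. vector_bounded (test_topology \<Omega>) A \<and> 0 < \<epsilon>}.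
      \<forall>w\<in>W. (\<lambda>f. u f + w f) \<in> ?U"
    using e by blast
qed blast

text \<open>Given a bounded \<open>A\<close>, the order of choices is \<open>c\<close>,
  \<open>n\<close>, \<open>d\<close>, \<open>m\<close>: the bound on values fixes \<open>c\<close>
  and hence \<open>n\<close>, the bound on the derivative \<open>js n\<close> fixes
  \<open>d\<close>, and \<open>m\<close> is free to exceed \<open>1 / d\<close>.\<close>

lemma zero_in_closure_of_steep_distribution_set:
  fixes f0 :: "real^'n \<Rightarrow> 'k::real_normed_field"
  assumes f0: "f0 \<in> test_functions_in \<Omega> L" "f0 q = 1" and "q \<notin> K" "K \<inter> L = {}"
    and g: "\<And>n m. g n m \<in> test_functions_in \<Omega> K"
    and steep: "\<And>n m. \<exists>y. real m < norm (partials (js n) (g n m) y)"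
  shows "(\<lambda>_. 0) \<in> distribution_topology \<Omega> closure_of
    {u \<in> distributions \<Omega>. \<exists>n m. 1 / (real n + 1) < norm (u f0) \<and> 1 < norm (u (g n m))}"
    (is "_ \<in> _ closure_of ?U")
  unfolding in_closure_of
proof (intro conjI allI impI)
  show "(\<lambda>_. 0) \<in> topspace (distribution_topology \<Omega> :: ((real^'n \<Rightarrow> 'k) \<Rightarrow> 'k) topology)"
    by (simp add: topspace_distribution_topology zero_distribution)
  fix T :: "((real^'n \<Rightarrow> 'k) \<Rightarrow> 'k) set"
  assume "(\<lambda>_. 0) \<in> T \<and> openin (distribution_topology \<Omega>) T"
  then obtain A \<epsilon> where A: "vector_bounded (test_topology \<Omega>) A" and \<epsilon>: "0 < \<epsilon>"
    and "\<forall>w\<in>strong_basic \<Omega> A \<epsilon>. (\<lambda>f. 0 + w f) \<in> T"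
    unfolding openin_distribution_topology by blast
  then have AT: "strong_basic \<Omega> A \<epsilon> \<subseteq> T" by auto
  have AD: "A \<subseteq> test_functions \<Omega>" using A by (simp add: vector_bounded_def topspace_test_topology)
  obtain C where C: "C > 0" "\<And>f x. f \<in> A \<Longrightarrow> norm (partials [] f x) \<le> C"
    using vector_bounded_partials[OF A] by blast
  \<comment> \<open>Each of the two point evaluations gets a quarter of \<open>\<epsilon>\<close> on
    \<open>A\<close>.\<close>
  define c where "c = \<epsilon> / (4 * C)"
  have c: "0 < c" "c * C = \<epsilon> / 4" using \<epsilon> C(1) by (auto simp: c_def)
  obtain n where n: "1 / (real n + 1) < c"
    using reals_Archimedean[OF c(1)] by (auto simp: inverse_eq_divide add.commute)
  obtain D where D: "D > 0" "\<And>f x. f \<in> A \<Longrightarrow> norm (partials (js n) f x) \<le> D"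
    using vector_bounded_partials[OF A] by blast
  define d where "d = \<epsilon> / (4 * D)"
  have d: "0 < d" "d * D = \<epsilon> / 4" using \<epsilon> D(1) by (auto simp: d_def)
  obtain m where m: "1 / d < real m" using reals_Archimedean2 by blast
  obtain y where y: "real m < norm (partials (js n) (g n m) y)" using steep by blast
  \<comment> \<open>Disjointness of \<open>K\<close> and \<open>L\<close> decouples the summands of
    \<open>u\<close>: \<open>f0\<close> sees only the evaluation at \<open>q\<close>, and
    \<open>g n m\<close> only the derivative at \<open>y\<close>.\<close>
  have "y \<in> K"
  proof (rule ccontr)
    assume "y \<notin> K"
    then show False using y test_functions_in_partials_eq_0[OF g, of y] by simp
  qed
  then have "y \<notin> L" using assms(4) by blast
  define u :: "(real^'n \<Rightarrow> 'k) \<Rightarrow> 'k" where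
    "u = (\<lambda>f. of_real c * partial_at \<Omega> [] q f + of_real d * partial_at \<Omega> (js n) y f)"
  have uD: "u \<in> distributions \<Omega>"
    unfolding u_def by (intro distributions_lincomb partial_at_distribution)
  have u: "u f = of_real c * f q + of_real d * partials (js n) f y" if "f \<in> test_functions \<Omega>" for f
    using that by (simp add: u_def partial_at_def)
  have "u f0 = of_real c"
    using u[of f0] f0 test_functions_in_partials_eq_0[OF f0(1) \<open>y \<notin> L\<close>] by (simp add: test_functions_in_def)
  then have "1 / (real n + 1) < norm (u f0)" using n c(1) by simp
  moreover have "u (g n m) = of_real d * partials (js n) (g n m) y"
    using u[of "g n m"] g[of n m] test_functions_in_partials_eq_0[OF g[of n m] \<open>q \<notin> K\<close>, of "[]"]
    by (simp add: test_functions_in_def)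
  then have "norm (u (g n m)) = d * norm (partials (js n) (g n m) y)" using d(1) by (simp add: norm_mult)
  moreover have "1 < d * norm (partials (js n) (g n m) y)"
  proof -
    have "1 < d * real m" using m d(1) by (simp add: field_simps)
    also have "\<dots> \<le> d * norm (partials (js n) (g n m) y)" using y d(1) by (intro mult_left_mono) auto
    finally show ?thesis .
  qed
  ultimately have "1 / (real n + 1) < norm (u f0) \<and> 1 < norm (u (g n m))" by simp
  then have "u \<in> ?U" using uD by blast
  moreover have "norm (u f) < \<epsilon>" if f: "f \<in> A" for f
  proof -
    have "norm (u f) \<le> c * norm (f q) + d * norm (partials (js n) f y)"
      using u[of f] f AD c(1) d(1) norm_triangle_ineq[of "of_real c * f q" "of_real d * partials (js n) f y"]
      by (auto simp: norm_mult)
    also have "\<dots> \<le> c * C + d * D"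
      using C(2)[OF f, of q] D(2)[OF f, of y] c(1) d(1) by (intro add_mono mult_left_mono) auto
    also have "\<dots> < \<epsilon>" using c(2) d(2) \<epsilon> by simp
    finally show ?thesis .
  qed
  then have "u \<in> T" using AT uD by (auto simp: strong_basic_def)
  ultimately show "\<exists>y. y \<in> ?U \<and> y \<in> T" by blast
qed

text \<open>For a fixed list of directions all but finitely many members have \<open>\<nu> j\<close>
  at least its length, hence bound 1; the finitely many others are bounded one by one.\<close>

lemma steep_family_vector_bounded:
  fixes g :: "nat \<Rightarrow> nat \<Rightarrow> real^'n \<Rightarrow> 'k::real_normed_field"
  assumes K: "compact K" "K \<subseteq> \<Omega>" and g: "\<And>n m. g n m \<in> test_functions_in \<Omega> K"
    and small: "\<And>n m is x. length is \<le> n \<Longrightarrow> norm (partials is (g n m) x) \<le> 1"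
    and fin: "\<And>N. finite {j. \<nu> j < N}"
  shows "vector_bounded (test_topology \<Omega>) (range (\<lambda>j::nat. g (\<nu> j) (\<mu> j)))"
proof (rule vector_bounded_testI[OF K])
  show "range (\<lambda>j. g (\<nu> j) (\<mu> j)) \<subseteq> test_functions_in \<Omega> K" using g by blast
  fix "is" :: "'n list"
  have "g n m \<in> test_functions \<Omega>" for n m using g[of n m] by (simp add: test_functions_in_def)
  then have "\<exists>C. \<forall>x. norm (partials is (g (\<nu> j) (\<mu> j)) x) \<le> C" for j
    using test_function_partials_bounded by blast
  then obtain B where B: "\<And>j x. norm (partials is (g (\<nu> j) (\<mu> j)) x) \<le> B j" by metis
  let ?J = "{j. \<nu> j < length is}"
  have "norm (partials is (g (\<nu> j) (\<mu> j)) x) \<le> Max (insert 1 (B ` ?J))" for j x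
  proof (cases "j \<in> ?J")
    case True
    then have "B j \<le> Max (insert 1 (B ` ?J))" using fin by (intro Max_ge) auto
    then show ?thesis using B[of j x] by linarith
  next
    case False
    then have "norm (partials is (g (\<nu> j) (\<mu> j)) x) \<le> 1" by (intro small) simp
    moreover have "1 \<le> Max (insert 1 (B ` ?J))" using fin by (intro Max_ge) auto
    ultimately show ?thesis by linarith
  qed
  then show "\<exists>C. \<forall>f\<in>range (\<lambda>j. g (\<nu> j) (\<mu> j)). \<forall>x. norm (partials is f x) \<le> C" by blast
qed

lemma distribution_topology_not_kappa_Frechet_Urysohn:
  fixes \<Omega> :: "(real^'n) set"
  assumes "open \<Omega>" "\<Omega> \<noteq> {}"
  shows "\<not> kappa_Frechet_Urysohn
    (distribution_topology \<Omega> :: ((real^'n \<Rightarrow> 'k::real_normed_field) \<Rightarrow> 'k) topology)"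
proof
  assume kFU: "kappa_Frechet_Urysohn (distribution_topology \<Omega> :: ((real^'n \<Rightarrow> 'k) \<Rightarrow> 'k) topology)"
  obtain p R where R: "0 < R" "cball p R \<subseteq> \<Omega>" using assms open_contains_cball by blast
  obtain i :: 'n where True by blast
  define q where "q = p + (R / 2) *\<^sub>R axis i 1"
  have pq: "dist p q = R / 2" using R(1) by (simp add: q_def dist_norm)
  \<comment> \<open>Since 2/5 < 1/2 and 1/2 + 1/5 < 1, balls of radius \<open>R / 5\<close> about
    \<open>p\<close> and \<open>q\<close> are disjoint and both lie in
    \<open>cball p R\<close>.\<close>
  define K where "K = cball p (R / 5)"
  define L where "L = cball q (R / 5)"
  have K: "K \<subseteq> \<Omega>" "compact K"
    using R unfolding K_def by (auto simp: subset_iff)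
  have "L \<subseteq> cball p R"
  proof
    fix x assume "x \<in> L"
    then show "x \<in> cball p R" using dist_triangle[of p x q] pq R(1) by (simp add: L_def)
  qed
  then have L: "L \<subseteq> \<Omega>" using R(2) by blast
  have KL: "K \<inter> L = {}"
  proof -
    have False if "x \<in> K" "x \<in> L" for x
      using that dist_triangle2[of p q x] pq R(1) unfolding K_def L_def mem_cball by linarith
    then show ?thesis by blast
  qed
  have "q \<in> L" using R(1) by (simp add: L_def)
  then have "q \<notin> K" using KL by blast
  obtain f0 :: "real^'n \<Rightarrow> 'k" where f0: "f0 \<in> test_functions_in \<Omega> L" "f0 q = 1"
    using exists_test_bump[of "R / 5" q \<Omega>, where 'k = 'k] R(1) L by (auto simp: L_def)
  have "\<forall>n m. \<exists>g :: real^'n \<Rightarrow> 'k. g \<in> test_functions_in \<Omega> K \<and>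
      (\<forall>is. length is \<le> n \<longrightarrow> (\<forall>x. norm (partials is g x) \<le> 1)) \<and>
      (\<exists>y. real m < norm (partials (replicate (Suc n) i) g y))"
    unfolding K_def using R(1) K(1) by (intro allI exists_steep_test_function) (auto simp: K_def)
  then obtain g :: "nat \<Rightarrow> nat \<Rightarrow> real^'n \<Rightarrow> 'k" where g: "\<And>n m. g n m \<in> test_functions_in \<Omega> K"
    and small: "\<And>n m is x. length is \<le> n \<Longrightarrow> norm (partials is (g n m) x) \<le> 1"
    and steep: "\<And>n m. \<exists>y. real m < norm (partials (replicate (Suc n) i) (g n m) y)"
    by metis
  let ?U = "{u \<in> distributions \<Omega>. \<exists>n m. 1 / (real n + 1) < norm (u f0) \<and> 1 < norm (u (g n m))}"
  have f0D: "f0 \<in> test_functions \<Omega>" and gD: "\<And>n m. g n m \<in> test_functions \<Omega>"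
    using f0(1) g by (auto simp: test_functions_in_def)
  have "(\<lambda>_. 0) \<in> distribution_topology \<Omega> closure_of ?U"
    by (rule zero_in_closure_of_steep_distribution_set[OF f0 \<open>q \<notin> K\<close> KL g steep])
  then obtain \<sigma> :: "nat \<Rightarrow> (real^'n \<Rightarrow> 'k) \<Rightarrow> 'k" where \<sigma>: "range \<sigma> \<subseteq> ?U"
    and lim: "limitin (distribution_topology \<Omega>) \<sigma> (\<lambda>_. 0) sequentially"
    using kappa_Frechet_UrysohnD[OF kFU openin_steep_distribution_set[of f0 \<Omega> g, OF f0D gD]] by blast
  have "\<exists>n m. 1 / (real n + 1) < norm (\<sigma> j f0) \<and> 1 < norm (\<sigma> j (g n m))" for j
  proof -
    have "\<sigma> j \<in> ?U" using \<sigma> by blast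
    then show ?thesis by blast
  qed
  then obtain \<nu> \<mu> where \<nu>: "\<And>j. 1 / (real (\<nu> j) + 1) < norm (\<sigma> j f0)"
    and \<mu>: "\<And>j. 1 < norm (\<sigma> j (g (\<nu> j) (\<mu> j)))"
    by metis
  \<comment> \<open>Eventually \<open>norm (\<sigma> j f0)\<close> is below
    \<open>1 / (real N + 1)\<close>, which forces \<open>\<nu> j\<close> above
    \<open>N\<close>.\<close>
  have fin: "finite {j. \<nu> j < N}" for N
  proof (rule finite_nat_if_eventually_not)
    let ?\<epsilon> = "1 / (real N + 1)"
    have "0 < ?\<epsilon>" by simp
    from limitin_eventually_mem[OF lim openin_strong_basic_interior[OF vector_bounded_singleton[OF f0D]]
        zero_strong_basic_interior[OF this]]
    show "\<forall>\<^sub>F j in sequentially. \<not> \<nu> j < N"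
    proof eventually_elim
      case (elim j)
      then have "1 / (real (\<nu> j) + 1) < 1 / (real N + 1)" using \<nu>[of j] by auto
      then show ?case by (simp add: field_simps)
    qed
  qed
  have bdd: "vector_bounded (test_topology \<Omega>) (range (\<lambda>j. g (\<nu> j) (\<mu> j)))"
    by (rule steep_family_vector_bounded[OF K(2,1) g small fin])
  \<comment> \<open>Uniform convergence on the set of all witnesses makes some
    \<open>\<sigma> j\<close> smaller than 1 at its own witness.\<close>
  from eventually_happens'[OF sequentially_bot limitin_eventually_mem[OF lim
      openin_strong_basic_interior[OF bdd] zero_strong_basic_interior[OF zero_less_one]]]
  obtain j \<eta> where "\<eta> < 1" "norm (\<sigma> j (g (\<nu> j) (\<mu> j))) \<le> \<eta>"
    by blast
  then show False using \<mu>[of j] by linarith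
qed

theorem mainTheorem7:
  fixes \<Omega> :: "(real^'n) set"
  assumes "open \<Omega>" and "\<Omega> \<noteq> {}"
  shows "\<not> kappa_Frechet_Urysohn
             (test_topology \<Omega> :: (real^'n \<Rightarrow> 'k::{real_normed_field, euclidean_space}) topology)
       \<and> \<not> kappa_Frechet_Urysohn
             (distribution_topology \<Omega> :: ((real^'n \<Rightarrow> 'k) \<Rightarrow> 'k) topology)"
  using test_topology_not_kappa_Frechet_Urysohn[OF assms]
    distribution_topology_not_kappa_Frechet_Urysohn[OF assms] by blast

end
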